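(* For all integers $k,M>0$ and $g\ge 0$, $$\epsilon_g(k,M) \;=\; \frac{(-1)^k\, k!}{kM+1}\sum_{p=0}^{2g} \genfrac{[}{]}{0pt}{}{kM+1}{p+kM+1-2g}\binom{p+kM+1-2g}{p+k}\genfrac{\{}{\}}{0pt}{}{p+k}{k}(-M)^{p+k}.$$
   Context: Unsigned Stirling numbers of the first kind $\genfrac{[}{]}{0pt}{}{n}{j}$: coefficients of the rising factorial, $X(X+1)\cdots(X+n-1)=\sum_{j=0}^n \genfrac{[}{]}{0pt}{}{n}{j}X^j$; they are $0$ for $j<0$ or $j>n$. Stirling numbers of the second kind $\genfrac{\{}{\}}{0pt}{}{n}{j}$: number of ways to partition a set of $n$ labelled objects into $j$ non-empty subsets. Binomial coefficients $\binom{a}{b}$ with $0\le a<b$ are $0$, and any term of the sum whose first-kind Stirling number has a negative lower index is $0$. The numbers $\epsilon_g(k,M)$: take one polygon with $kM$ sides (a $kM$-gon) and $k$ distinct (labelled) polygons with $M$ sides each ($M$-gons); all polygons are oriented and all sides are distinguishable (degenerate polygons with one or two sides are allowed: an $m$-gon is an oriented closed disk whose boundary circle is divided into $m$ arcs). A bipartite pairing is a bijection between the $kM$ sides of the $kM$-gon and the $kM$ sides of the $k$ $M$-gons altogether (so no side of the $kM$-gon is paired with another side of the $kM$-gon, and no side of an $M$-gon is paired with a side of an $M$-gon). Given such a pairing, each pair of sides is identified as one edge without twist (compatibly with the orientations of the polygons), which yields a closed connected orientable surface. For an integer $g\ge 0$, $\epsilon_g(k,M)$ is the number of bipartite pairings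 for which the resulting surface has genus $g$. *)

theory Defs
  imports Complex_Main "HOL-Library.FuncSet" "HOL-Combinatorics.Stirling"
begin

text \<open>
  Sides of the one big polygon and of the labelled small polygons: \<open>Inl i\<close> is side \<open>i\<close> of the
  \<open>k M\<close>-gon, \<open>Inr (a, j)\<close> is side \<open>j\<close> of the \<open>a\<close>-th \<open>M\<close>-gon. Sides are numbered in the cyclic
  order given by the orientation of the polygon.
\<close>

type_synonym side = "nat + nat \<times> nat"

definition sides :: "nat \<Rightarrow> nat \<Rightarrow> side set" where
  "sides k M = {..<k * M} <+> ({..<k} \<times> {..<M})"

text \<open>An \<open>m\<close>-gon with \<open>m = 1\<close> has a single side, which is its own successor.\<close>

fun next_side :: "nat \<Rightarrow> nat \<Rightarrow> side \<Rightarrow> side" where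
  "next_side k M (Inl i) = Inl (Suc i mod (k * M))"
| "next_side k M (Inr (a, j)) = Inr (a, Suc j mod M)"

text \<open>Bipartite pairings; the extensional function space makes them countable as functions.\<close>

definition bipartite_pairings :: "nat \<Rightarrow> nat \<Rightarrow> (nat \<Rightarrow> nat \<times> nat) set" where
  "bipartite_pairings k M =
     {f \<in> {..<k * M} \<rightarrow>\<^sub>E {..<k} \<times> {..<M}. bij_betw f {..<k * M} ({..<k} \<times> {..<M})}"

text \<open>
  Each corner of a polygon is the initial point of exactly one side and is named by that side;
  the terminal point of side \<open>s\<close> is thus the corner \<open>next_side k M s\<close>. Two paired sides are
  identified without twist, i.e. reversing their directions, so that the orientations of the
  polygons agree on the resulting surface: the initial point of each is glued to the terminal
  point of the other.
\<close>

definition corner_gluing :: "nat \<Rightarrow> nat \<Rightarrow> (nat \<Rightarrow> nat \<times> nat) \<Rightarrow> side rel" where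
  "corner_gluing k M f =
     (\<Union>i<k * M. {(Inl i, next_side k M (Inr (f i))), (next_side k M (Inl i), Inr (f i))})"

text \<open>
  The vertices, edges and faces of the resulting cell decomposition. An edge is the class of the
  two sides identified with each other; a face is an (uncut) polygon, given by its set of sides.
\<close>

definition surface_vertices :: "nat \<Rightarrow> nat \<Rightarrow> (nat \<Rightarrow> nat \<times> nat) \<Rightarrow> side set set" where
  "surface_vertices k M f =
     sides k M // (corner_gluing k M f \<union> (corner_gluing k M f)\<inverse>)\<^sup>*"

definition surface_edges :: "nat \<Rightarrow> nat \<Rightarrow> (nat \<Rightarrow> nat \<times> nat) \<Rightarrow> side set set" where
  "surface_edges k M f = (\<lambda>i. {Inl i, Inr (f i)}) ` {..<k * M}"

definition surface_faces :: "nat \<Rightarrow> nat \<Rightarrow> side set set" where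
  "surface_faces k M = insert (Inl ` {..<k * M}) ((\<lambda>a. Inr ` ({a} \<times> {..<M})) ` {..<k})"

definition euler_char :: "nat \<Rightarrow> nat \<Rightarrow> (nat \<Rightarrow> nat \<times> nat) \<Rightarrow> int" where
  "euler_char k M f =
     int (card (surface_vertices k M f)) - int (card (surface_edges k M f))
       + int (card (surface_faces k M))"

text \<open>
  The surface is closed, orientable (no twists) and connected (for \<open>k, M > 0\<close> every small polygon
  is glued to the big one), so its genus \<open>g\<close> is determined by \<open>\<chi> = 2 - 2 g\<close>.
\<close>

definition has_genus :: "nat \<Rightarrow> nat \<Rightarrow> (nat \<Rightarrow> nat \<times> nat) \<Rightarrow> nat \<Rightarrow> bool" where
  "has_genus k M f g \<longleftrightarrow> euler_char k M f = 2 - 2 * int g"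

definition eps :: "nat \<Rightarrow> nat \<Rightarrow> nat \<Rightarrow> nat" where
  "eps g k M = card {f \<in> bipartite_pairings k M. has_genus k M f g}"

text \<open>Unsigned Stirling numbers of the first kind, extended by zero to negative lower index.\<close>

definition stirling_int :: "nat \<Rightarrow> int \<Rightarrow> nat" where
  "stirling_int n j = (if j < 0 then 0 else stirling n (nat j))"

end

theory Submission
  imports Defs "HOL-Combinatorics.Cycles" "HOL-Combinatorics.Multiset_Permutations"
    "HOL-Computational_Algebra.Formal_Power_Series" "HOL-Computational_Algebra.Polynomial"
begin

text \<open>
  Let \<open>n = k M\<close>, let \<open>S\<close> be the set of the \<open>n\<close> sides of the small polygons and let \<open>\<sigma>\<close> be the
  permutation of \<open>S\<close> that turns every small polygon by one side, a product of \<open>k\<close> cycles of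
  length \<open>M\<close>. A pairing \<open>f\<close> lists \<open>S\<close> in some order \<open>f 0, \<dots>, f (n - 1)\<close>. Following the corners
  around a vertex of the surface, one passes from the side \<open>f i\<close> to \<open>\<sigma> (f (i + 1))\<close>, so the
  vertices are the orbits of \<open>\<sigma> \<circ> u\<close>, where \<open>u\<close> is the \<open>n\<close>-cycle \<open>(f 0 \<dots> f (n - 1))\<close>
  (\<open>card_surface_vertices\<close>). There are \<open>n\<close> edges and \<open>k + 1\<close> faces, so genus \<open>g\<close> means that there
  are \<open>n + 1 - k - 2 g\<close> orbits, and the task is to find the distribution of the number of orbits
  of \<open>\<sigma> \<circ> u\<close> over all \<open>n\<close>-cycles \<open>u\<close>.

  This is done for an arbitrary permutation \<open>w\<close> of \<open>S\<close> with cycle lengths \<open>\<lambda>\<^sub>1, \<lambda>\<^sub>2, \<dots>\<close>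
  (\<open>cyclic_sum_eq_orbit_gf\<close>):
    \<open>\<Sum>q. X^q \<Sum>u. q^(orbits of w \<circ> u) = (n - 1)! X (1 - X^\<lambda>\<^sub>1) (1 - X^\<lambda>\<^sub>2) \<dots> / (1 - X)^(n + 2)\<close>,
  where \<open>u\<close> runs through all \<open>n\<close>-cycles. The proof is by induction on \<open>n\<close>. Write
  \<open>u = (z x) \<circ> u'\<close> with a cycle \<open>u'\<close> on \<open>S - {z}\<close>. Deleting \<open>z\<close> from \<open>w \<circ> (z x)\<close> leaves a
  permutation of \<open>S - {z}\<close>. If \<open>w\<close> fixes \<open>z\<close>, this is just the restriction of \<open>w\<close>. Otherwise it
  arises from \<open>w\<close> by dropping \<open>z\<close> from its cycle and then cutting that cycle in two or merging
  it with another one, depending on \<open>x\<close>; for one choice of \<open>x\<close> the cycle is only shortened and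
  \<open>z\<close> becomes an orbit by itself, which costs a factor \<open>q\<close> (\<open>cyclic_sum_recursion\<close>). Multiplication by \<open>q\<close> acts on the series as \<open>X d/dX\<close>, and
  \<open>orbit_gf_recursion\<close> is the verification that the right-hand side obeys the same recursion.
  The induction needs all cycle types, even though only \<open>\<sigma>\<close> matters in the end, because cutting
  and merging destroys the equality of the cycle lengths.

  For \<open>w = \<sigma>\<close> the product is \<open>(1 - X^M)^k\<close>. Expanding it by the binomial theorem shows that
  the sum of \<open>q^(number of vertices)\<close> over all pairings is
    \<open>1/(n + 1) \<Sum>j. (-1)^j (k choose j) (q - j M) (q - j M + 1) \<dots> (q - j M + n)\<close>
  for \<open>q > n\<close>, hence as polynomials in \<open>q\<close>. In the coefficient of a power of \<open>q\<close> the rising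
  factorial contributes the Stirling numbers of the first kind, the shift by \<open>j M\<close> a binomial
  coefficient and a power of \<open>- M\<close>, and the alternating sum over \<open>j\<close> the Stirling numbers of
  the second kind (\<open>sum_alternating_binomial_power\<close>).
\<close>

section \<open>Counting orbits of a permutation\<close>

abbreviation equiv_closure :: "'a rel \<Rightarrow> 'a rel" where
  "equiv_closure R \<equiv> (R \<union> R\<inverse>)\<^sup>*"

text \<open>
  Orbits are taken as classes of the equivalence relation generated by \<open>x \<sim> p x\<close>, so that
  they can be compared with the vertices of a surface, which are classes of a generated
  equivalence relation too.
\<close>

definition orbit_count :: "'a set \<Rightarrow> ('a \<Rightarrow> 'a) \<Rightarrow> nat" where
  "orbit_count S p = card (S // equiv_closure {(x, p x) |x. x \<in> S})"

lemma sym_equiv_closure: "sym (equiv_closure R)"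
  by (intro sym_rtrancl sym_Un_converse)

lemma equiv_closure_sym: "(x, y) \<in> equiv_closure R \<Longrightarrow> (y, x) \<in> equiv_closure R"
  using sym_equiv_closure by (rule symD)

lemma equiv_closure_Image_eq_iff:
  "equiv_closure R `` {x} = equiv_closure R `` {y} \<longleftrightarrow> (x, y) \<in> equiv_closure R"
  by (auto intro: rtrancl_trans dest: equiv_closure_sym)

lemma equiv_closure_map:
  assumes "(x, y) \<in> equiv_closure R"
    and "\<And>x y. (x, y) \<in> R \<Longrightarrow> (h x, h y) \<in> equiv_closure R'"
  shows "(h x, h y) \<in> equiv_closure R'"
  using assms(1)
proof induction
  case (step y z)
  from step.hyps(2) have "(h y, h z) \<in> equiv_closure R'"
    by (auto dest: assms(2) intro: equiv_closure_sym)
  with step.IH show ?case by (rule rtrancl_trans)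
qed simp

lemma card_image_eq_of_kernel:
  assumes "\<And>x y. x \<in> S \<Longrightarrow> y \<in> S \<Longrightarrow> f x = f y \<longleftrightarrow> g x = g y"
  shows "card (f ` S) = card (g ` S)"
proof -
  define \<phi> where "\<phi> = (\<lambda>a. g (inv_into S f a))"
  have \<phi>: "\<phi> (f x) = g x" if "x \<in> S" for x
    unfolding \<phi>_def using assms[of "inv_into S f (f x)" x] that
    by (simp add: f_inv_into_f inv_into_into)
  have "g ` S = \<phi> ` f ` S" by (simp add: image_image \<phi>)
  moreover have "inj_on \<phi> (f ` S)" using assms by (auto simp: inj_on_def \<phi>)
  ultimately show ?thesis by (simp add: card_image)
qed

text \<open>
  Two presentations of the same quotient: maps back and forth that respect the generating
  relations and are mutually inverse up to equivalence induce a bijection of the classes.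
\<close>

lemma card_quotient_eq:
  assumes S: "h ` S \<subseteq> T" and T: "g ` T \<subseteq> S"
    and h: "\<And>x y. (x, y) \<in> R \<Longrightarrow> (h x, h y) \<in> equiv_closure R'"
    and g: "\<And>a b. (a, b) \<in> R' \<Longrightarrow> (g a, g b) \<in> equiv_closure R"
    and gh: "\<And>x. x \<in> S \<Longrightarrow> (g (h x), x) \<in> equiv_closure R"
    and hg: "\<And>a. a \<in> T \<Longrightarrow> (h (g a), a) \<in> equiv_closure R'"
  shows "card (S // equiv_closure R) = card (T // equiv_closure R')"
proof -
  define F where "F = (\<lambda>x. equiv_closure R `` {x})"
  define F' where "F' = (\<lambda>x. equiv_closure R' `` {x})"
  have "F x = F y \<longleftrightarrow> F' (h x) = F' (h y)" if "x \<in> S" "y \<in> S" for x y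
  proof -
    have "(x, y) \<in> equiv_closure R" if "(h x, h y) \<in> equiv_closure R'"
    proof -
      have "(g (h x), g (h y)) \<in> equiv_closure R" using that g by (rule equiv_closure_map)
      then show ?thesis using gh[OF \<open>x \<in> S\<close>] gh[OF \<open>y \<in> S\<close>]
        by (meson equiv_closure_sym rtrancl_trans)
    qed
    moreover have "(h x, h y) \<in> equiv_closure R'" if "(x, y) \<in> equiv_closure R"
      using that h by (rule equiv_closure_map)
    ultimately show ?thesis unfolding F_def F'_def equiv_closure_Image_eq_iff by blast
  qed
  then have "card (F ` S) = card ((\<lambda>x. F' (h x)) ` S)" by (rule card_image_eq_of_kernel)
  also have "(\<lambda>x. F' (h x)) ` S = F' ` T"
  proof
    show "(\<lambda>x. F' (h x)) ` S \<subseteq> F' ` T" using S by auto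
    show "F' ` T \<subseteq> (\<lambda>x. F' (h x)) ` S"
    proof
      fix A assume "A \<in> F' ` T"
      then obtain a where "a \<in> T" "A = F' a" by auto
      moreover have "F' (h (g a)) = F' a"
        using hg[OF \<open>a \<in> T\<close>] unfolding F'_def equiv_closure_Image_eq_iff .
      ultimately show "A \<in> (\<lambda>x. F' (h x)) ` S" using T by auto
    qed
  qed
  finally show ?thesis by (simp add: F_def F'_def quotient_def UNION_singleton_eq_range)
qed

lemma orbit_count_fixpoint:
  assumes "finite S" and z: "z \<in> S" "p z = z" and p: "p permutes S"
  shows "orbit_count S p = Suc (orbit_count (S - {z}) p)"
proof -
  define R where "R = {(x, p x) |x. x \<in> S - {z}}"
  define E where "E = equiv_closure R"
  have "{(x, p x) |x. x \<in> S} = insert (z, z) R" using z by (auto simp: R_def)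
  then have E: "equiv_closure {(x, p x) |x. x \<in> S} = E"
    unfolding E_def by (auto intro!: rtrancl_subset)
  have "p x \<noteq> z" if "x \<noteq> z" for x using permutes_inj[OF p] z that by (metis injD)
  then have R: "R \<union> R\<inverse> \<subseteq> (- {z}) \<times> (- {z})" by (auto simp: R_def)
  have z': "(z, y) \<in> E \<Longrightarrow> y = z" for y
    unfolding E_def by (induction rule: rtrancl_induct) (use R in auto)
  have "S // E = insert (E `` {z}) ((S - {z}) // E)"
    using z by (auto simp: quotient_def)
  moreover have "E `` {z} \<notin> (S - {z}) // E"
  proof
    assume "E `` {z} \<in> (S - {z}) // E"
    then obtain y where "y \<in> S - {z}" "E `` {z} = E `` {y}" by (elim quotientE) blast
    then show False using z' unfolding E_def equiv_closure_Image_eq_iff by blast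
  qed
  moreover have "finite ((S - {z}) // E)" using \<open>finite S\<close> by (auto simp: quotient_def)
  ultimately show ?thesis
    unfolding orbit_count_def E by (simp add: E_def R_def)
qed

text \<open>
  Cutting a point \<open>z\<close> out of a longer cycle, by sending the predecessor of \<open>z\<close> directly to its
  successor, does not change the number of cycles.
\<close>

lemma orbit_count_bypass:
  assumes z: "z \<in> S" and p: "p permutes S"
    and p': "\<And>y. y \<in> S - {z} \<Longrightarrow> p' y = (if p y = z then p z else p y)"
    and nz: "p z \<noteq> z"
  shows "orbit_count S p = orbit_count (S - {z}) p'"
  unfolding orbit_count_def
proof (rule card_quotient_eq)
  let ?R = "{(x, p x) |x. x \<in> S}" and ?R' = "{(x, p' x) |x. x \<in> S - {z}}"
  \<comment> \<open>Retract \<open>S\<close> onto \<open>S - {z}\<close> by moving \<open>z\<close> along its own orbit.\<close>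
  let ?h = "\<lambda>x. if x = z then p z else x"
  have pS: "p x \<in> S" if "x \<in> S" for x using p that by (simp add: permutes_in_image)
  show "?h ` S \<subseteq> S - {z}" using pS nz z by auto
  show "id ` (S - {z}) \<subseteq> S" by auto
  show "(?h x, ?h y) \<in> equiv_closure ?R'" if "(x, y) \<in> ?R" for x y
  proof -
    from that have "x \<in> S" "y = p x" by auto
    show ?thesis
    proof (cases "x = z")
      case True then show ?thesis using \<open>y = p x\<close> nz by simp
    next
      case False
      then have "p' x = ?h y" using p'[of x] \<open>x \<in> S\<close> \<open>y = p x\<close> by auto
      then have "(x, ?h y) \<in> ?R'" using False \<open>x \<in> S\<close> by force
      then show ?thesis using False by auto
    qed
  qed
  have R: "(x, p x) \<in> equiv_closure ?R" if "x \<in> S" for x using that by auto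
  show "(id a, id b) \<in> equiv_closure ?R" if "(a, b) \<in> ?R'" for a b
  proof -
    from that have a: "a \<in> S - {z}" "b = p' a" by auto
    show ?thesis using p'[OF a(1)] a R[of a] R[of z] z
      by (auto split: if_splits intro: rtrancl_trans)
  qed
  show "(id (?h x), x) \<in> equiv_closure ?R" if "x \<in> S" for x
    using R[OF z] by (auto intro: equiv_closure_sym)
  show "(?h (id a), a) \<in> equiv_closure ?R'" if "a \<in> S - {z}" for a using that by auto
qed

section \<open>Summing over all full cycles\<close>

text \<open>Since the list is made to start at \<open>z\<close>, every cyclic permutation of \<open>S\<close> is counted exactly
  once. The value therefore does not depend on \<open>z\<close>; the induction below proves this along the way,
  by computing it for every \<open>z\<close>.\<close>

definition cyclic_sum :: "real \<Rightarrow> 'a set \<Rightarrow> ('a \<Rightarrow> 'a) \<Rightarrow> 'a \<Rightarrow> real" where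
  "cyclic_sum q S w z =
     (\<Sum>l\<in>permutations_of_set (S - {z}). q ^ orbit_count S (w \<circ> cycle_of_list (z # l)))"

lemma cyclic_sum_first_step:
  assumes "z \<in> S" "S \<noteq> {z}"
  shows "cyclic_sum q S w z = (\<Sum>x\<in>S - {z}. \<Sum>l\<in>permutations_of_set (S - {z} - {x}).
           q ^ orbit_count S (w \<circ> transpose z x \<circ> cycle_of_list (x # l)))"
proof (cases "finite S")
  case True
  have ne: "S - {z} \<noteq> {}" using assms by auto
  have "cyclic_sum q S w z = (\<Sum>l\<in>(\<Union>x\<in>S - {z}. (#) x ` permutations_of_set (S - {z} - {x})).
           q ^ orbit_count S (w \<circ> cycle_of_list (z # l)))"
    unfolding cyclic_sum_def permutations_of_set_nonempty[OF ne] ..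
  also have "\<dots> = (\<Sum>x\<in>S - {z}. \<Sum>l\<in>(#) x ` permutations_of_set (S - {z} - {x}).
           q ^ orbit_count S (w \<circ> cycle_of_list (z # l)))"
    using True by (intro sum.UNION_disjoint) auto
  also have "\<dots> = (\<Sum>x\<in>S - {z}. \<Sum>l\<in>permutations_of_set (S - {z} - {x}).
           q ^ orbit_count S (w \<circ> cycle_of_list (z # x # l)))"
    by (simp add: sum.reindex)
  finally show ?thesis by (simp add: comp_assoc)
qed (simp add: cyclic_sum_def permutations_of_set_infinite)

lemma cycle_of_list_permutes_Diff:
  assumes "x \<in> S - {z}" "l \<in> permutations_of_set (S - {z} - {x})"
  shows "cycle_of_list (x # l) permutes (S - {z})"
  using cycle_permutes[of "x # l"] assms by (simp add: permutations_of_set_def insert_absorb)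

text \<open>
  If \<open>w\<close> fixes \<open>z\<close>, then deleting \<open>z\<close> from \<open>w \<circ> (z x)\<close> gives back the restriction of \<open>w\<close>, whatever
  \<open>x\<close> is: \<open>x\<close> goes to \<open>z\<close> and \<open>z\<close> goes to \<open>w x\<close>.
\<close>

lemma cyclic_sum_fixpoint:
  assumes S: "finite S" "z \<in> S" "S \<noteq> {z}" and w: "w permutes S" "w z = z"
  shows "cyclic_sum q S w z = (\<Sum>x\<in>S - {z}. cyclic_sum q (S - {z}) w x)"
  unfolding cyclic_sum_first_step[OF S(2,3)]
proof (intro sum.cong refl)
  have injw: "w a = w b \<longleftrightarrow> a = b" for a b using permutes_inj[OF w(1)] by (rule inj_eq)
  fix x assume x: "x \<in> S - {z}"
  have "orbit_count S (w \<circ> transpose z x \<circ> cycle_of_list (x # l)) =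
      orbit_count (S - {z}) (w \<circ> cycle_of_list (x # l))"
    if l: "l \<in> permutations_of_set (S - {z} - {x})" for l
  proof (rule orbit_count_bypass[OF S(2)])
    let ?u = "cycle_of_list (x # l)"
    have u: "?u permutes (S - {z})" using x l by (rule cycle_of_list_permutes_Diff)
    then have uz: "?u z = z" by (simp add: permutes_not_in)
    have "?u permutes S" using u by (rule permutes_subset) auto
    moreover have "transpose z x permutes S" using x S(2) by (intro permutes_swap_id) auto
    ultimately show "w \<circ> transpose z x \<circ> ?u permutes S"
      using w(1) by (intro permutes_compose)
    have wx: "w x \<noteq> z" using x injw[of x z] w(2) by auto
    then show "(w \<circ> transpose z x \<circ> ?u) z \<noteq> z" using uz by simp
    fix y assume "y \<in> S - {z}"
    then have "?u y \<noteq> z" using permutes_in_image[OF u, of y] by auto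
    then show "(w \<circ> ?u) y = (if (w \<circ> transpose z x \<circ> ?u) y = z
        then (w \<circ> transpose z x \<circ> ?u) z else (w \<circ> transpose z x \<circ> ?u) y)"
      using uz wx w(2) injw by (auto simp: transpose_def)
  qed
  then show "(\<Sum>l\<in>permutations_of_set (S - {z} - {x}).
           q ^ orbit_count S (w \<circ> transpose z x \<circ> cycle_of_list (x # l))) = cyclic_sum q (S - {z}) w x"
    unfolding cyclic_sum_def by (intro sum.cong) auto
qed

text \<open>
  Here \<open>v\<close> is \<open>w\<close> with \<open>z\<close> dropped from its cycle, where \<open>t\<close> was the predecessor of \<open>z\<close>. For
  \<open>x = t\<close> the permutation \<open>w \<circ> (z x)\<close> fixes \<open>z\<close>, which is then an orbit by itself and gives the
  factor \<open>q\<close>. For any other \<open>x\<close>, deleting \<open>z\<close> from \<open>w \<circ> (z x)\<close> leaves \<open>v \<circ> (t x)\<close>.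
\<close>

lemma cyclic_sum_recursion:
  assumes S: "finite S" "z \<in> S" and w: "w permutes S" and t: "w t = z" "t \<noteq> z"
  defines "v \<equiv> w \<circ> transpose z t"
  shows "cyclic_sum q S w z = q * cyclic_sum q (S - {z}) v t +
           (\<Sum>x\<in>S - {z} - {t}. cyclic_sum q (S - {z}) (v \<circ> transpose t x) x)"
proof -
  have injw: "w a = w b \<longleftrightarrow> a = b" for a b using permutes_inj[OF w] by (rule inj_eq)
  have wz: "w z \<noteq> z" using t injw[of t z] by auto
  have tS: "t \<in> S - {z}" using t S(2) permutes_in_image[OF w, of t] by auto
  define f where "f x = (\<Sum>l\<in>permutations_of_set (S - {z} - {x}).
           q ^ orbit_count S (w \<circ> transpose z x \<circ> cycle_of_list (x # l)))" for x
  have perm: "w \<circ> transpose z x \<circ> cycle_of_list (x # l) permutes S"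
    if "x \<in> S - {z}" "l \<in> permutations_of_set (S - {z} - {x})" for x l
  proof -
    have "cycle_of_list (x # l) permutes S"
      using cycle_of_list_permutes_Diff[OF that] by (rule permutes_subset) auto
    moreover have "transpose z x permutes S" using that S(2) by (intro permutes_swap_id) auto
    ultimately show ?thesis using w by (intro permutes_compose)
  qed
  have ft: "f t = q * cyclic_sum q (S - {z}) v t"
  proof -
    have "orbit_count S (w \<circ> transpose z t \<circ> cycle_of_list (t # l)) =
        Suc (orbit_count (S - {z}) (v \<circ> cycle_of_list (t # l)))"
      if l: "l \<in> permutations_of_set (S - {z} - {t})" for l
      unfolding v_def
    proof (rule orbit_count_fixpoint[OF S _ perm[OF tS l]])
      have "cycle_of_list (t # l) z = z"
        using cycle_of_list_permutes_Diff[OF tS l] by (simp add: permutes_not_in)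
      then show "(w \<circ> transpose z t \<circ> cycle_of_list (t # l)) z = z" using t by simp
    qed
    then show ?thesis unfolding f_def cyclic_sum_def sum_distrib_left by (intro sum.cong) auto
  qed
  have fx: "f x = cyclic_sum q (S - {z}) (v \<circ> transpose t x) x" if x: "x \<in> S - {z} - {t}" for x
  proof -
    have xS: "x \<in> S - {z}" using x by simp
    have "orbit_count S (w \<circ> transpose z x \<circ> cycle_of_list (x # l)) =
        orbit_count (S - {z}) (v \<circ> transpose t x \<circ> cycle_of_list (x # l))"
      if l: "l \<in> permutations_of_set (S - {z} - {x})" for l
    proof (rule orbit_count_bypass[OF S(2) perm[OF xS l]])
      let ?u = "cycle_of_list (x # l)"
      have u: "?u permutes (S - {z})" using xS l by (rule cycle_of_list_permutes_Diff)
      then have uz: "?u z = z" by (simp add: permutes_not_in)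
      have wx: "w x \<noteq> z" using x t injw[of x t] by auto
      then show "(w \<circ> transpose z x \<circ> ?u) z \<noteq> z" using uz by simp
      fix y assume "y \<in> S - {z}"
      then have "?u y \<noteq> z" using permutes_in_image[OF u, of y] by auto
      then show "(v \<circ> transpose t x \<circ> ?u) y = (if (w \<circ> transpose z x \<circ> ?u) y = z
          then (w \<circ> transpose z x \<circ> ?u) z else (w \<circ> transpose z x \<circ> ?u) y)"
        using uz wx wz t x injw unfolding v_def by (auto simp: transpose_def)
    qed
    then show ?thesis unfolding f_def cyclic_sum_def by (intro sum.cong) auto
  qed
  have "S \<noteq> {z}" using tS by auto
  then have "cyclic_sum q S w z = (\<Sum>x\<in>S - {z}. f x)"
    using cyclic_sum_first_step[OF S(2)] by (simp add: f_def)
  also have "\<dots> = f t + (\<Sum>x\<in>S - {z} - {t}. f x)" using tS S(1) by (intro sum.remove) auto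
  finally show ?thesis using ft fx by simp
qed

lemma cyclic_sum_singleton:
  assumes "w permutes {z}"
  shows "cyclic_sum q {z} w z = q"
  using orbit_count_fixpoint[of "{z}" z w] assms
  by (simp add: cyclic_sum_def orbit_count_def quotient_def)

section \<open>Cycles of a permutation as lists\<close>

text \<open>
  A cycle is written as a list that \<open>w\<close> runs through from left to right and then back to the
  head. In the form \<open>map w (last c # butlast c) = c\<close> this condition is stable under
  concatenation: \<open>is_cycle_append_commute\<close> and \<open>is_cycle_transpose_iff\<close> come down to cutting an
  equation between lists at a given length.
\<close>

definition is_cycle :: "('a \<Rightarrow> 'a) \<Rightarrow> 'a list \<Rightarrow> bool" where
  "is_cycle w c \<longleftrightarrow> c \<noteq> [] \<and> distinct c \<and> map w (last c # butlast c) = c"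

lemma is_cycleD:
  assumes "is_cycle w c"
  shows "c \<noteq> []" "distinct c"
  using assms unfolding is_cycle_def by blast+

lemma is_cycle_snoc:
  "is_cycle w (A @ [x]) \<longleftrightarrow> distinct (A @ [x]) \<and> map w (x # A) = A @ [x]"
  by (simp add: is_cycle_def)

lemma is_cycle_cong: "(\<And>x. x \<in> set c \<Longrightarrow> w x = w' x) \<Longrightarrow> is_cycle w c \<Longrightarrow> is_cycle w' c"
proof -
  assume eq: "\<And>x. x \<in> set c \<Longrightarrow> w x = w' x" and c: "is_cycle w c"
  have "map w (last c # butlast c) = map w' (last c # butlast c)"
    by (rule map_cong) (use is_cycleD[OF c] eq in \<open>auto dest: in_set_butlastD\<close>)
  moreover have "map w (last c # butlast c) = c" using c unfolding is_cycle_def by (elim conjE)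
  ultimately have "map w' (last c # butlast c) = c" by (rule trans[OF sym])
  with c show "is_cycle w' c" unfolding is_cycle_def by (intro conjI; (elim conjE)?; assumption?)
qed

lemma is_cycle_append_commute:
  assumes "is_cycle w (A @ B)"
  shows "is_cycle w (B @ A)"
proof (cases A rule: rev_cases; cases B rule: rev_cases)
  fix A' a B' b assume AB: "A = A' @ [a]" "B = B' @ [b]"
  have "map w (b # A') @ map w (a # B') = (A' @ [a]) @ (B' @ [b])"
    using assms is_cycle_snoc[of w "A' @ [a] @ B'" b] by (simp add: AB)
  then have "map w (b # A') = A' @ [a]" "map w (a # B') = B' @ [b]"
    by (subst (asm) append_eq_append_conv; simp)+
  moreover have "distinct (B' @ [b] @ A' @ [a])"
    using is_cycleD[OF assms] by (auto simp: AB)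
  ultimately show ?thesis
    using is_cycle_snoc[of w "B' @ [b] @ A'" a] by (simp add: AB)
qed (use assms in auto)

lemma is_cycle_remove:
  assumes "is_cycle w (z # C @ [t])"
  shows "w t = z" and "is_cycle (w \<circ> transpose z t) (C @ [t])"
proof -
  have *: "distinct (z # C @ [t])" "w t = z" "map w (z # C) = C @ [t]"
    using assms is_cycle_snoc[of w "z # C" t] by auto
  show "w t = z" by fact
  have "map (w \<circ> transpose z t) C = map w C"
    using *(1) by (auto simp: transpose_def)
  then show "is_cycle (w \<circ> transpose z t) (C @ [t])" using *
    by (simp add: is_cycle_snoc del: map_eq_conv)
qed

lemma is_cycle_fixpoint: "is_cycle w [z] \<Longrightarrow> w z = z"
  by (simp add: is_cycle_def)

text \<open>
  Composing with the transposition of the last elements of two consecutive segments cuts a cycle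
  between the segments. Read from right to left, with \<open>v \<circ> transpose t x\<close> in the role of the
  given permutation, it merges two cycles.
\<close>

lemma is_cycle_transpose_iff:
  assumes d: "distinct (A @ [x] @ B @ [t])"
  shows "is_cycle v (A @ [x] @ B @ [t]) \<longleftrightarrow>
    is_cycle (v \<circ> transpose t x) (A @ [x]) \<and> is_cycle (v \<circ> transpose t x) (B @ [t])"
proof -
  let ?v = "v \<circ> transpose t x"
  have "map ?v A = map v A" "map ?v B = map v B" using d by (auto simp: transpose_def)
  then have m: "map ?v (x # A) = map v (t # A)" "map ?v (t # B) = map v (x # B)"
    by (simp_all del: map_eq_conv)
  have dist: "distinct (A @ [x])" "distinct (B @ [t])" using d by auto
  have "is_cycle v (A @ [x] @ B @ [t]) \<longleftrightarrow> map v (t # A) @ map v (x # B) = (A @ [x]) @ (B @ [t])"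
    using is_cycle_snoc[of v "A @ [x] @ B" t] d by simp
  also have "\<dots> \<longleftrightarrow> map v (t # A) = A @ [x] \<and> map v (x # B) = B @ [t]"
    by (subst append_eq_append_conv) simp_all
  also have "\<dots> \<longleftrightarrow> is_cycle ?v (A @ [x]) \<and> is_cycle ?v (B @ [t])"
    by (simp only: is_cycle_snoc dist m simp_thms)
  finally show ?thesis .
qed

text \<open>
  Fixed points count as cycles of length one here. Hence a permutation \<open>w\<close> of \<open>S\<close> is described
  completely by a set \<open>R\<close> of disjoint cycles with \<open>\<Union> (set ` R) = S\<close>.
\<close>

definition disjoint_cycles :: "'a list set \<Rightarrow> ('a \<Rightarrow> 'a) \<Rightarrow> bool" where
  "disjoint_cycles R w \<longleftrightarrow>
     finite R \<and> (\<forall>c\<in>R. is_cycle w c) \<and> pairwise (\<lambda>c d. set c \<inter> set d = {}) R"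

text \<open>
  Cycles are non-empty, so a list that is disjoint from all members of \<open>R\<close> cannot belong to \<open>R\<close>;
  that is why \<open>c \<notin> R\<close> can stand on the left of the equivalence.
\<close>

lemma disjoint_cycles_insert:
  "c \<notin> R \<and> disjoint_cycles (insert c R) w \<longleftrightarrow>
     is_cycle w c \<and> disjoint_cycles R w \<and> set c \<inter> \<Union> (set ` R) = {}"
proof (cases "c \<in> R")
  case True
  have "\<not> (is_cycle w c \<and> set c \<inter> \<Union> (set ` R) = {})"
  proof
    assume c: "is_cycle w c \<and> set c \<inter> \<Union> (set ` R) = {}"
    have "set c \<subseteq> \<Union> (set ` R)" using True by (rule UN_upper)
    with c have "set c = {}" by (simp add: Int_absorb2)
    then show False using is_cycleD(1)[of w c] c by simp
  qed
  then show ?thesis using True by blast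
next
  case False
  then have ne: "d \<noteq> c" if "d \<in> R" for d using that by auto
  have "pairwise (\<lambda>c d. set c \<inter> set d = {}) (insert c R) \<longleftrightarrow>
      (\<forall>d\<in>R. set c \<inter> set d = {}) \<and> pairwise (\<lambda>c d. set c \<inter> set d = {}) R"
    unfolding pairwise_insert by (rule arg_cong2[where f = "(\<and>)"]) (use ne in \<open>auto simp: Int_commute\<close>)
  moreover have "set c \<inter> \<Union> (set ` R) = {} \<longleftrightarrow> (\<forall>d\<in>R. set c \<inter> set d = {})"
    by auto
  ultimately show ?thesis using False by (simp add: disjoint_cycles_def conj_ac)
qed

lemma disjoint_cycles_Diff:
  assumes "disjoint_cycles R w" "c \<in> R"
  shows "is_cycle w c" "disjoint_cycles (R - {c}) w" "set c \<inter> \<Union> (set ` (R - {c})) = {}"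
  using assms disjoint_cycles_insert[of c "R - {c}" w] by (auto simp: insert_absorb)

lemma disjoint_cycles_cong:
  "(\<And>x. x \<in> \<Union> (set ` R) \<Longrightarrow> w x = w' x) \<Longrightarrow> disjoint_cycles R w \<Longrightarrow> disjoint_cycles R w'"
  unfolding disjoint_cycles_def by (auto intro: is_cycle_cong[of _ w])

lemma card_cycles: 
  assumes "disjoint_cycles R w"
  shows "card (\<Union> (set ` R)) = (\<Sum>c\<in>R. length c)"
proof -
  have "card (\<Union> (set ` R)) = (\<Sum>c\<in>R. card (set c))"
    using assms by (intro card_UN_disjoint) (auto simp: disjoint_cycles_def pairwise_def)
  also have "\<dots> = (\<Sum>c\<in>R. length c)"
    using assms by (intro sum.cong refl distinct_card is_cycleD(2)[of w]) (simp add: disjoint_cycles_def)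
  finally show ?thesis .
qed

section \<open>The generating function and its recursion\<close>

definition cycle_weight :: "'a list set \<Rightarrow> real fps" where
  "cycle_weight R = (\<Prod>c\<in>R. 1 - fps_X ^ length c)"

lemma cycle_weight_insert:
  "finite R \<Longrightarrow> c \<notin> R \<Longrightarrow> cycle_weight (insert c R) = (1 - fps_X ^ length c) * cycle_weight R"
  by (simp add: cycle_weight_def)

lemma disjoint_cycles_insertD:
  assumes "is_cycle w c" "disjoint_cycles R w" "set c \<inter> \<Union> (set ` R) = {}"
  shows "disjoint_cycles (insert c R) w"
    and "cycle_weight (insert c R) = (1 - fps_X ^ length c) * cycle_weight R"
  using assms disjoint_cycles_insert[of c R w]
  by (auto intro!: cycle_weight_insert simp: disjoint_cycles_def)

lemma fps_XD_mult: "fps_XD (a * b) = fps_XD a * b + a * fps_XD (b :: 'a :: comm_ring_1 fps)"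
  by (simp add: fps_XD_def algebra_simps)

lemma fps_XD_X_power: "fps_XD (fps_X ^ m) = of_nat m * (fps_X ^ m :: 'a :: comm_ring_1 fps)"
  by (rule fps_ext) (auto simp: fps_XD_def fps_X_power_iff fps_X_power_mult_nth
     simp flip: fps_of_nat)

text \<open>
  The left-hand side collects the effect of merging a cycle of length \<open>m\<close> at each of the \<open>length d\<close>
  points of every cycle \<open>d\<close> in \<open>R\<close>. The logarithmic derivative of \<open>cycle_weight R\<close> is
  \<open>- \<Sum>d. length d * X^length d / (1 - X^length d)\<close> (after multiplication by \<open>X\<close>), and
  \<open>1 - X^(l + m) - (1 - X^m) X^l = 1 - X^l\<close> cancels the remaining denominators.
\<close>

lemma cycle_weight_join:
  assumes "finite R"
  shows "(\<Sum>d\<in>R. of_nat (length d) * ((1 - fps_X ^ (length d + m)) * cycle_weight (R - {d}))) =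
     of_nat (\<Sum>d\<in>R. length d) * cycle_weight R - (1 - fps_X ^ m) * fps_XD (cycle_weight R)"
proof -
  have XD: "fps_XD (cycle_weight R) =
      - (\<Sum>d\<in>R. of_nat (length d) * fps_X ^ length d * cycle_weight (R - {d}))"
    using assms
  proof induction
    case (insert c R)
    have "(\<Sum>d\<in>R. of_nat (length d) * fps_X ^ length d * cycle_weight (insert c R - {d})) =
        (1 - fps_X ^ length c) *
          (\<Sum>d\<in>R. of_nat (length d) * fps_X ^ length d * cycle_weight (R - {d}))"
      unfolding sum_distrib_left
    proof (intro sum.cong refl)
      fix d assume "d \<in> R"
      then have "insert c R - {d} = insert c (R - {d})" using insert by auto
      then have "cycle_weight (insert c R - {d}) = (1 - fps_X ^ length c) * cycle_weight (R - {d})"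
        using insert by (simp add: cycle_weight_insert)
      then show "of_nat (length d) * fps_X ^ length d * cycle_weight (insert c R - {d}) =
         (1 - fps_X ^ length c) * (of_nat (length d) * fps_X ^ length d * cycle_weight (R - {d}))"
        by (simp only: mult_ac)
    qed
    moreover have "insert c R - {c} = R" using insert by auto
    moreover have "fps_XD (cycle_weight (insert c R)) =
        - (of_nat (length c) * fps_X ^ length c) * cycle_weight R
        + (1 - fps_X ^ length c) * fps_XD (cycle_weight R)"
    proof -
      have "fps_XD (1 - fps_X ^ length c :: real fps) = - (of_nat (length c) * fps_X ^ length c)"
        using fps_XD_X_power[of "length c", where 'a = real] by (simp add: fps_XD_def)
      then show ?thesis
        by (simp only: cycle_weight_insert[OF insert.hyps] fps_XD_mult)
    qed
    ultimately show ?case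
      by (simp only: sum.insert[OF insert.hyps] insert.IH) simp
  qed (simp add: cycle_weight_def fps_XD_def)
  have "of_nat (\<Sum>d\<in>R. length d) * cycle_weight R =
      (\<Sum>d\<in>R. of_nat (length d) * ((1 - fps_X ^ length d) * cycle_weight (R - {d})))"
    unfolding of_nat_sum sum_distrib_right
    by (intro sum.cong refl) (use assms in \<open>simp add: cycle_weight_def prod.remove\<close>)
  then show ?thesis unfolding XD
    by (simp add: sum_distrib_left sum_negf sum.distrib sum_subtractf algebra_simps power_add)
qed

text \<open>
  The left-hand side collects the effect of cutting a cycle of length \<open>Suc k\<close> at each of its \<open>k\<close>
  inner places.
\<close>

lemma cycle_weight_split:
  "(1 - fps_X) * (\<Sum>i<k. (1 - fps_X ^ Suc i) * (1 - fps_X ^ (k - i))) =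
     of_nat k * (1 + fps_X ^ Suc k) * (1 - fps_X) - 2 * (fps_X - fps_X ^ Suc k :: real fps)"
proof -
  have 1: "(1 - fps_X) * (\<Sum>i<k. fps_X ^ Suc i :: real fps) = fps_X - fps_X ^ Suc k" for k
  proof (induction k)
    case (Suc k)
    show ?case
      by (simp only: sum.lessThan_Suc distrib_left Suc.IH) (simp add: algebra_simps)
  qed simp
  have 2: "(\<Sum>i<k. fps_X ^ (k - i) :: real fps) = (\<Sum>i<k. fps_X ^ Suc i)"
    using sum.nat_diff_reindex[of "\<lambda>i. fps_X ^ Suc i :: real fps" k]
    by (simp add: Suc_diff_Suc)
  have "(\<Sum>i<k. (1 - fps_X ^ Suc i) * (1 - fps_X ^ (k - i)) :: real fps) =
      (\<Sum>i<k. (1 + fps_X ^ Suc k) - fps_X ^ Suc i - fps_X ^ (k - i))"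
  proof (intro sum.cong refl)
    fix i assume "i \<in> {..<k}"
    then have "fps_X ^ Suc i * fps_X ^ (k - i) = (fps_X ^ Suc k :: real fps)"
      by (simp flip: power_add)
    then show "(1 - fps_X ^ Suc i) * (1 - fps_X ^ (k - i)) =
        (1 + fps_X ^ Suc k) - fps_X ^ Suc i - (fps_X ^ (k - i) :: real fps)"
      by (simp add: algebra_simps)
  qed
  also have "\<dots> = of_nat k * (1 + fps_X ^ Suc k) - 2 * (\<Sum>i<k. fps_X ^ Suc i)"
    by (simp only: sum_subtractf 2) (simp add: algebra_simps)
  finally have sum: "(\<Sum>i<k. (1 - fps_X ^ Suc i) * (1 - fps_X ^ (k - i)) :: real fps) =
      of_nat k * (1 + fps_X ^ Suc k) - 2 * (\<Sum>i<k. fps_X ^ Suc i)" .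
  have distr: "(1 - fps_X) * (of_nat k * (1 + fps_X ^ Suc k) - 2 * S) =
      of_nat k * (1 + fps_X ^ Suc k) * (1 - fps_X) - 2 * ((1 - fps_X) * S)" for S :: "real fps"
    by (simp add: algebra_simps)
  show ?thesis unfolding sum distr 1 ..
qed

abbreviation geom :: "real fps" where "geom \<equiv> inverse (1 - fps_X)"

text \<open>
  For \<open>P = cycle_weight R\<close>, where \<open>R\<close> consists of the cycles of a permutation of \<open>n\<close> points, the
  coefficient of \<open>X^q\<close> will be the value of \<open>cyclic_sum q\<close>.
\<close>

definition orbit_gf :: "nat \<Rightarrow> real fps \<Rightarrow> real fps" where
  "orbit_gf n P = of_nat (fact (n - 1)) * fps_X * P * geom ^ (n + 2)"

lemma geom_mult: "geom * (1 - fps_X) = 1" "(1 - fps_X) * geom = 1"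
  by (rule inverse_mult_eq_1 inverse_mult_eq_1'; simp)+

lemma fps_XD_geom: "fps_XD geom = fps_X * geom ^ 2"
  by (simp add: fps_XD_def fps_inverse_deriv)

lemma fps_XD_geom_power: "fps_XD (geom ^ k) = of_nat k * fps_X * geom ^ Suc k"
proof (induction k)
  case (Suc k)
  show ?case
    by (simp only: power_Suc[of geom k] fps_XD_mult fps_XD_geom Suc.IH)
      (simp add: algebra_simps power2_eq_square)
qed (simp add: fps_XD_def)

lemma orbit_gf_single: "fps_nth (orbit_gf 1 (1 - fps_X)) q = real q"
proof -
  have "orbit_gf 1 (1 - fps_X) = (geom * (1 - fps_X)) * (fps_X * geom ^ 2)"
    by (simp add: orbit_gf_def power3_eq_cube power2_eq_square mult_ac)
  also have "\<dots> = fps_XD geom" unfolding geom_mult fps_XD_geom by simp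
  finally have "fps_nth (orbit_gf 1 (1 - fps_X)) q = real q * fps_nth geom q" by simp
  also have "fps_nth geom q = 1" by (simp only: fps_inverse_one_minus_fps_X fps_nth_Abs_fps)
  finally show ?thesis by simp
qed

text \<open>
  A fixed point contributes the factor \<open>1 - X\<close>, which cancels one factor of the denominator.
\<close>

lemma orbit_gf_fixpoint:
  assumes "n \<ge> 2"
  shows "orbit_gf n ((1 - fps_X) * P) = of_nat (n - 1) * orbit_gf (n - 1) P"
proof -
  obtain N where n: "n = N + 2" using assms by (metis add.commute le_Suc_ex)
  have "orbit_gf n ((1 - fps_X) * P) =
     (geom * (1 - fps_X)) * (of_nat (fact (Suc N)) * fps_X * P * geom ^ (N + 3))"
    by (simp add: orbit_gf_def n numeral_eq_Suc mult_ac)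
  also have "\<dots> = of_nat (fact (Suc N)) * fps_X * P * geom ^ (N + 3)"
    unfolding geom_mult by simp
  also have "\<dots> = of_nat (n - 1) * orbit_gf (n - 1) P"
    by (simp add: orbit_gf_def n numeral_eq_Suc mult_ac fact_Suc del: of_nat_fact) (simp add: algebra_simps)
  finally show ?thesis .
qed

text \<open>
  The counterpart of \<open>cyclic_sum_recursion\<close>, for a point that lies in a cycle of length \<open>m + 1\<close>
  and the remaining cycles \<open>R\<close>. The first summand comes from the factor \<open>q\<close>, the second one from
  cutting the shortened cycle of length \<open>m\<close>, the third one from merging it with a cycle \<open>d\<close>.
\<close>

lemma orbit_gf_recursion:
  assumes "finite R" and n: "n = m + 1 + (\<Sum>d\<in>R. length d)" and m: "m \<ge> 1"
  shows "orbit_gf n ((1 - fps_X ^ (m + 1)) * cycle_weight R) =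
    fps_XD (orbit_gf (n - 1) ((1 - fps_X ^ m) * cycle_weight R))
    + (\<Sum>i<m - 1. orbit_gf (n - 1) ((1 - fps_X ^ Suc i) * ((1 - fps_X ^ (m - 1 - i)) * cycle_weight R)))
    + (\<Sum>d\<in>R. of_nat (length d) *
         orbit_gf (n - 1) ((1 - fps_X ^ (length d + m)) * cycle_weight (R - {d})))"
proof -
  obtain k where k: "m = Suc k" using m by (cases m) auto
  define s where "s = (\<Sum>d\<in>R. length d)"
  define N where "N = k + s"
  have N: "n = N + 2" by (simp add: n k N_def s_def)
  define W D where "W = cycle_weight R" and "D = fps_XD W"
  define Z where "Z = (fps_X ^ m :: real fps)"
  define f where "f = (of_nat (fact N) :: real fps)"
  \<comment> \<open>The part of \<open>orbit_gf (n - 1)\<close> that is common to all summands.\<close>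
  define G where "G = f * fps_X * geom ^ (N + 3)"
  define L where "L = (\<Sum>i<k. (1 - fps_X ^ Suc i) * (1 - fps_X ^ (k - i)) :: real fps)"
  have gf: "orbit_gf (n - 1) P = P * G" for P
    by (simp add: orbit_gf_def N G_def f_def numeral_eq_Suc mult_ac)
  have XDG: "fps_XD G = G + of_nat (N + 3) * fps_X * geom * G"
  proof -
    have "fps_XD f = 0" by (simp add: f_def fps_XD_def flip: fps_of_nat)
    moreover have "fps_XD fps_X = (fps_X :: real fps)" by (simp add: fps_XD_def)
    ultimately show ?thesis
      unfolding G_def fps_XD_mult fps_XD_geom_power power_Suc by (simp add: algebra_simps)
  qed
  have XDZ: "fps_XD ((1 - Z) * W) = (1 - Z) * D - of_nat m * Z * W"
  proof -
    have "fps_XD (1 - Z) = - (of_nat m * Z)"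
      using fps_XD_X_power[of m] by (simp add: Z_def fps_XD_def algebra_simps)
    then show ?thesis unfolding fps_XD_mult D_def by (simp add: mult_ac)
  qed
  \<comment> \<open>The identity that remains when the common factor \<open>W * G\<close> is removed; the terms with the
    derivative \<open>D\<close> of the other cycles cancel.\<close>
  have bracket: "of_nat (N + 1) * (1 - fps_X * Z) * geom =
      (1 - Z) - of_nat m * Z + of_nat (N + 3) * fps_X * (1 - Z) * geom + L + of_nat s"
    (is "?l = ?r")
  proof -
    have "(1 - fps_X) * ?l = ((1 - fps_X) * geom) * (of_nat (N + 1) * (1 - fps_X * Z))"
      by (simp only: mult_ac)
    also have "\<dots> = of_nat (N + 1) * (1 - fps_X * Z)" by (simp only: geom_mult mult_1)
    also have "\<dots> = (1 - fps_X) * ((1 - Z) - of_nat m * Z + of_nat s)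
        + of_nat (N + 3) * fps_X * (1 - Z)
        + (of_nat k * (1 + Z) * (1 - fps_X) - 2 * (fps_X - Z))"
      by (simp add: N_def k algebra_simps)
    also have "of_nat k * (1 + Z) * (1 - fps_X) - 2 * (fps_X - Z) = (1 - fps_X) * L"
      using cycle_weight_split[of k] by (simp add: L_def Z_def k)
    also have "of_nat (N + 3) * fps_X * (1 - Z) =
        ((1 - fps_X) * geom) * (of_nat (N + 3) * fps_X * (1 - Z))"
      by (simp only: geom_mult mult_1)
    finally have "(1 - fps_X) * ?l = (1 - fps_X) * ?r" by (simp add: algebra_simps)
    moreover have "1 - fps_X \<noteq> (0 :: real fps)"
      using geom_mult by fastforce
    ultimately show ?thesis by simp
  qed
  have "orbit_gf n ((1 - fps_X ^ (m + 1)) * W) = of_nat (N + 1) * (1 - fps_X * Z) * geom * (W * G)"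
    by (simp add: orbit_gf_def N G_def f_def Z_def numeral_eq_Suc mult_ac) (simp add: algebra_simps)
  also have "\<dots> = fps_XD ((1 - Z) * W * G) + L * W * G
      + (of_nat s * W - (1 - Z) * D) * G"
    unfolding bracket fps_XD_mult[of _ G] XDZ XDG by (simp add: algebra_simps)
  also have "L * W * G = (\<Sum>i<m - 1. orbit_gf (n - 1)
      ((1 - fps_X ^ Suc i) * ((1 - fps_X ^ (m - 1 - i)) * W)))"
    unfolding gf L_def sum_distrib_right by (simp add: k mult_ac)
  also have "of_nat s * W - (1 - Z) * D =
      (\<Sum>d\<in>R. of_nat (length d) * ((1 - fps_X ^ (length d + m)) * cycle_weight (R - {d})))"
    unfolding cycle_weight_join[OF \<open>finite R\<close>] s_def W_def D_def Z_def ..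
  finally show ?thesis unfolding gf sum_distrib_right by (simp add: W_def Z_def mult_ac)
qed

section \<open>The orbit distribution for an arbitrary cycle type\<close>

lemma disjoint_cycles_start_at:
  assumes "disjoint_cycles \<C> w" "z \<in> \<Union> (set ` \<C>)"
  obtains C R where "is_cycle w (z # C)" "disjoint_cycles R w"
    "set (z # C) \<inter> \<Union> (set ` R) = {}" "\<Union> (set ` \<C>) = set (z # C) \<union> \<Union> (set ` R)"
    "cycle_weight \<C> = (1 - fps_X ^ length (z # C)) * cycle_weight R"
proof -
  from assms(2) obtain c where c: "c \<in> \<C>" "z \<in> set c" by auto
  then obtain A B where AB: "c = A @ z # B" by (auto dest: split_list)
  note D = disjoint_cycles_Diff[OF assms(1) c(1)]
  have ins: "insert c (\<C> - {c}) = \<C>" using c(1) by auto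
  have sets: "set (z # B @ A) = set c" by (auto simp: AB)
  have "is_cycle w (z # B @ A)" using is_cycle_append_commute[of w A "z # B"] D(1) by (simp add: AB)
  moreover have "cycle_weight \<C> = (1 - fps_X ^ length (z # B @ A)) * cycle_weight (\<C> - {c})"
    using disjoint_cycles_insertD(2)[OF D] by (simp only: ins) (simp add: AB add.commute)
  moreover have "\<Union> (set ` \<C>) = set c \<union> \<Union> (set ` (\<C> - {c}))" using c(1) by auto
  ultimately show thesis using D(2,3) by (intro that[of "B @ A" "\<C> - {c}"]) (simp_all only: sets)
qed

lemma disjoint_cycles_split:
  assumes c: "is_cycle v (A @ [x] @ B @ [t])" and R: "disjoint_cycles R v"
    and disj: "set (A @ [x] @ B @ [t]) \<inter> \<Union> (set ` R) = {}"
  obtains \<D> where "disjoint_cycles \<D> (v \<circ> transpose t x)"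
    "\<Union> (set ` \<D>) = set (A @ [x] @ B @ [t]) \<union> \<Union> (set ` R)"
    "cycle_weight \<D> =
       (1 - fps_X ^ Suc (length A)) * ((1 - fps_X ^ Suc (length B)) * cycle_weight R)"
proof -
  have d: "distinct (A @ [x] @ B @ [t])" using c by (rule is_cycleD)
  let ?v = "v \<circ> transpose t x"
  have cyc: "is_cycle ?v (A @ [x])" "is_cycle ?v (B @ [t])"
    using c is_cycle_transpose_iff[OF d] by auto
  have R': "disjoint_cycles R ?v"
    using disj by (intro disjoint_cycles_cong[OF _ R]) (auto simp: transpose_def)
  have Rt: "set (B @ [t]) \<inter> \<Union> (set ` R) = {}" using disj by auto
  note 1 = disjoint_cycles_insertD[OF cyc(2) R' Rt]
  have "set (A @ [x]) \<inter> \<Union> (set ` insert (B @ [t]) R) = {}" using disj d by auto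
  note 2 = disjoint_cycles_insertD[OF cyc(1) 1(1) this]
  show thesis
  proof (rule that[OF 2(1)])
    show "\<Union> (set ` insert (A @ [x]) (insert (B @ [t]) R)) =
        set (A @ [x] @ B @ [t]) \<union> \<Union> (set ` R)" by auto
    show "cycle_weight (insert (A @ [x]) (insert (B @ [t]) R)) =
       (1 - fps_X ^ Suc (length A)) * ((1 - fps_X ^ Suc (length B)) * cycle_weight R)"
      unfolding 2(2) 1(2) by simp
  qed
qed

lemma disjoint_cycles_merge:
  assumes c: "is_cycle v (B @ [t])" and R: "disjoint_cycles R v"
    and disj: "set (B @ [t]) \<inter> \<Union> (set ` R) = {}" and d: "d \<in> R" "x \<in> set d"
  obtains \<D> where "disjoint_cycles \<D> (v \<circ> transpose t x)"
    "\<Union> (set ` \<D>) = set (B @ [t]) \<union> \<Union> (set ` R)"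
    "cycle_weight \<D> = (1 - fps_X ^ (length d + Suc (length B))) * cycle_weight (R - {d})"
proof -
  let ?v = "v \<circ> transpose t x"
  obtain D1 D2 where D: "d = D1 @ x # D2" using d(2) by (auto dest: split_list)
  define A where "A = D2 @ D1"
  note dR = disjoint_cycles_Diff[OF R d(1)]
  have A: "is_cycle v (A @ [x])"
    using is_cycle_append_commute[of v "D1 @ [x]" D2] dR(1) by (simp add: D A_def)
  have setd: "set d = set (A @ [x])" by (auto simp: D A_def)
  have dis: "set (B @ [t]) \<inter> set d = {}" using disj d(1) by blast
  have dist: "distinct (A @ [x] @ B @ [t])"
    using is_cycleD(2)[OF A] is_cycleD(2)[OF c] dis unfolding setd by auto
  have "?v \<circ> transpose t x = v" by (simp add: fun_eq_iff)
  then have cyc: "is_cycle ?v (A @ [x] @ B @ [t])"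
    using is_cycle_transpose_iff[OF dist, of ?v] A c by simp
  have disj': "set (A @ [x] @ B @ [t]) \<inter> \<Union> (set ` (R - {d})) = {}"
    using dR(3) disj unfolding setd by auto
  have "disjoint_cycles (R - {d}) ?v"
    using disj' by (intro disjoint_cycles_cong[OF _ dR(2)]) (auto simp: transpose_def)
  note 1 = disjoint_cycles_insertD[OF cyc this disj']
  show thesis
  proof (rule that[OF 1(1)])
    have "\<Union> (set ` R) = set d \<union> \<Union> (set ` (R - {d}))" using d(1) by auto
    then show "\<Union> (set ` insert (A @ [x] @ B @ [t]) (R - {d})) = set (B @ [t]) \<union> \<Union> (set ` R)"
      unfolding setd by auto
    show "cycle_weight (insert (A @ [x] @ B @ [t]) (R - {d})) =
        (1 - fps_X ^ (length d + Suc (length B))) * cycle_weight (R - {d})"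
      unfolding 1(2) by (simp add: D A_def ac_simps)
  qed
qed

text \<open>
  Induction on the number of points. The recursions for \<open>cyclic_sum\<close> lead to permutations of
  \<open>S - {z}\<close> whose cycles are those of \<open>w\<close> with \<open>z\<close> dropped and one cycle cut or two cycles
  merged, so every summand is known; the recursions for \<open>orbit_gf\<close> sum them up.
\<close>

theorem cyclic_sum_eq_orbit_gf:
  assumes "disjoint_cycles \<C> w" "S = \<Union> (set ` \<C>)" "w permutes S" "z \<in> S"
  shows "cyclic_sum (real q) S w z = fps_nth (orbit_gf (card S) (cycle_weight \<C>)) q"
  using assms
proof (induction "card S" arbitrary: S \<C> w z rule: less_induct)
  case less
  note w = \<open>w permutes S\<close> and z = \<open>z \<in> S\<close>
  have fin: "finite S" using less.prems(1,2) by (auto simp: disjoint_cycles_def)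
  obtain C R where C: "is_cycle w (z # C)" and R: "disjoint_cycles R w"
    and disj: "set (z # C) \<inter> \<Union> (set ` R) = {}"
    and union: "\<Union> (set ` \<C>) = set (z # C) \<union> \<Union> (set ` R)"
    and weight: "cycle_weight \<C> = (1 - fps_X ^ length (z # C)) * cycle_weight R"
    using disjoint_cycles_start_at[OF less.prems(1) less.prems(4)[unfolded less.prems(2)]] .
  have S: "S = set (z # C) \<union> \<Union> (set ` R)" using less.prems(2) union by simp
  have finR: "finite R" using R by (simp add: disjoint_cycles_def)
  have dC: "distinct (z # C)" using C by (rule is_cycleD)
  have "card S = card (set (z # C)) + card (\<Union> (set ` R))"
    unfolding S by (rule card_Un_disjoint) (use disj fin in \<open>simp_all add: S del: set_simps\<close>)
  then have card: "card S = length C + 1 + (\<Sum>d\<in>R. length d)"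
    using distinct_card[OF dC] card_cycles[OF R] by simp
  have S': "S - {z} = set C \<union> \<Union> (set ` R)" using S dC disj by auto
  have card': "card (S - {z}) = card S - 1" using fin z by simp
  have IH: "cyclic_sum (real q) (S - {z}) v x = fps_nth (orbit_gf (card S - 1) (cycle_weight \<D>)) q"
    if "disjoint_cycles \<D> v" "\<Union> (set ` \<D>) = S - {z}" "v permutes S - {z}" "x \<in> S - {z}" for \<D> v x
    unfolding card'[symmetric]
    by (rule less.hyps[OF _ that(1) that(2)[symmetric] that(3,4)]) (rule card_Diff1_less[OF fin z])
  show ?case
  proof (cases "C = []")
    case True
    have wz: "w z = z" using C True by (simp add: is_cycle_fixpoint)
    have weight: "cycle_weight \<C> = (1 - fps_X) * cycle_weight R" using weight True by simp
    show ?thesis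
    proof (cases "S = {z}")
      case single: True
      have "d \<notin> R" for d
      proof
        assume d: "d \<in> R"
        then have "d \<noteq> []" using disjoint_cycles_Diff(1)[OF R] is_cycleD(1) by blast
        then have "hd d \<in> \<Union> (set ` R)" using d hd_in_set by blast
        then show False using single S disj by auto
      qed
      then have "R = {}" by blast
      then have "cycle_weight \<C> = 1 - fps_X" using weight by (simp add: cycle_weight_def)
      then show ?thesis using cyclic_sum_singleton[of w z] orbit_gf_single w single by simp
    next
      case False
      have "card S \<ge> 2" using False z fin
        by (metis One_nat_def Suc_1 Suc_leI card_1_singleton_iff card_gt_0_iff empty_iff
            le_neq_implies_less singletonD)
      note fp = orbit_gf_fixpoint[OF this]
      have "w permutes S - {z}" using w wz by (intro permutes_superset[OF w]) auto
      then have "cyclic_sum (real q) S w z =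
          (\<Sum>x\<in>S - {z}. fps_nth (orbit_gf (card S - 1) (cycle_weight R)) q)"
        unfolding cyclic_sum_fixpoint[OF fin z False w wz]
        using R S' True by (intro sum.cong refl IH) auto
      also have "\<dots> = fps_nth (orbit_gf (card S) (cycle_weight \<C>)) q"
        unfolding weight fp using card' by (simp add: fps_of_nat[symmetric])
      finally show ?thesis .
    qed
  next
    case False
    define m where "m = length C"
    obtain B t where Bt: "C = B @ [t]" using False by (cases C rule: rev_cases) auto
    have m: "m = Suc (length B)" by (simp add: m_def Bt)
    define v where "v = w \<circ> transpose z t"
    have t: "w t = z" "t \<noteq> z" and vC: "is_cycle v C"
      using is_cycle_remove[of w z B t] C dC by (auto simp: Bt v_def)
    have tS: "t \<in> S - {z}" by (simp add: S' Bt)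
    have R': "disjoint_cycles R v"
      using disj by (intro disjoint_cycles_cong[OF _ R]) (auto simp: v_def transpose_def Bt)
    have disj': "set C \<inter> \<Union> (set ` R) = {}" using disj by auto
    have "v permutes S" unfolding v_def using w z tS by (intro permutes_compose permutes_swap_id) auto
    then have v: "v permutes S - {z}"
      by (rule permutes_superset) (use t in \<open>auto simp: v_def\<close>)
    have vx: "v \<circ> transpose t x permutes S - {z}" if "x \<in> S - {z}" for x
      using v that tS by (intro permutes_compose permutes_swap_id) auto
    define g where "g P = fps_nth (orbit_gf (card S - 1) P) q" for P
    define h where "h x = cyclic_sum (real q) (S - {z}) (v \<circ> transpose t x) x" for x
    have 1: "cyclic_sum (real q) (S - {z}) v t = g ((1 - fps_X ^ m) * cycle_weight R)"
      using IH[OF disjoint_cycles_insertD(1)[OF vC R' disj'] _ v tS] S'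
      by (simp add: disjoint_cycles_insertD(2)[OF vC R' disj'] g_def m_def)
    \<comment> \<open>If \<open>x = B ! i\<close> lies in the cycle of \<open>t\<close>, this cycle is cut behind \<open>x\<close>.\<close>
    have 2: "h (B ! i) = g ((1 - fps_X ^ Suc i) * ((1 - fps_X ^ (m - 1 - i)) * cycle_weight R))"
      if i: "i < m - 1" for i
    proof -
      have "C = take i B @ [B ! i] @ drop (Suc i) B @ [t]"
        using i id_take_nth_drop[of i B] by (simp add: Bt m)
      note C' = this
      obtain \<D> where D: "disjoint_cycles \<D> (v \<circ> transpose t (B ! i))" "\<Union> (set ` \<D>) = set C \<union> \<Union> (set ` R)"
        "cycle_weight \<D> = (1 - fps_X ^ Suc (length (take i B))) *
           ((1 - fps_X ^ Suc (length (drop (Suc i) B))) * cycle_weight R)"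
        using disjoint_cycles_split[of v "take i B" "B ! i" "drop (Suc i) B" t R]
          vC R' disj' unfolding C'[symmetric] .
      have "B ! i \<in> S - {z}" using i by (simp add: S' Bt m)
      then have "h (B ! i) = g (cycle_weight \<D>)"
        unfolding h_def g_def using D(1,2) S' by (intro IH vx) simp_all
      moreover have "Suc (length (drop (Suc i) B)) = m - 1 - i" "length (take i B) = i"
        using i by (simp_all add: m)
      ultimately show ?thesis by (simp only: D(3))
    qed
    \<comment> \<open>If \<open>x\<close> lies in another cycle \<open>d\<close>, it is merged with the cycle of \<open>t\<close>.\<close>
    have 3: "h x = g ((1 - fps_X ^ (length d + m)) * cycle_weight (R - {d}))"
      if d: "d \<in> R" "x \<in> set d" for d x
    proof -
      obtain \<D> where D: "disjoint_cycles \<D> (v \<circ> transpose t x)" "\<Union> (set ` \<D>) = set C \<union> \<Union> (set ` R)"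
        "cycle_weight \<D> = (1 - fps_X ^ (length d + m)) * cycle_weight (R - {d})"
        using disjoint_cycles_merge[of v B t R d x] vC R' disj' d unfolding m Bt .
      have "x \<in> S - {z}" using d by (auto simp: S')
      then have "h x = g (cycle_weight \<D>)"
        unfolding h_def g_def using D(1,2) S' by (intro IH vx) simp_all
      then show ?thesis by (simp only: D(3))
    qed
    have dB: "distinct B" using dC by (simp add: Bt)
    have "S - {z} - {t} = set B \<union> \<Union> (set ` R)" using S' dC disj' by (auto simp: Bt)
    then have "(\<Sum>x\<in>S - {z} - {t}. h x) = (\<Sum>x\<in>set B. h x) + (\<Sum>x\<in>\<Union> (set ` R). h x)"
      using disj' finR by (simp add: Bt) (intro sum.union_disjoint; auto)
    also have "(\<Sum>x\<in>set B. h x) = (\<Sum>i<m - 1. h (B ! i))"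
      using sum.reindex_bij_betw[OF bij_betw_nth[OF dB refl refl], of h] by (simp add: m)
    also have "(\<Sum>x\<in>\<Union> (set ` R). h x) = (\<Sum>d\<in>R. \<Sum>x\<in>set d. h x)"
      using R by (intro sum.UNION_disjoint) (auto simp: disjoint_cycles_def pairwise_def)
    also have "\<dots> = (\<Sum>d\<in>R. real (length d) *
        g ((1 - fps_X ^ (length d + m)) * cycle_weight (R - {d})))"
    proof (intro sum.cong refl)
      fix d assume d: "d \<in> R"
      then have "distinct d" using R by (auto simp: disjoint_cycles_def dest: is_cycleD)
      then show "(\<Sum>x\<in>set d. h x) =
          real (length d) * g ((1 - fps_X ^ (length d + m)) * cycle_weight (R - {d}))"
        using 3[OF d] by (simp add: distinct_card)
    qed
    finally have "cyclic_sum (real q) S w z = real q * g ((1 - fps_X ^ m) * cycle_weight R)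
      + ((\<Sum>i<m - 1. g ((1 - fps_X ^ Suc i) * ((1 - fps_X ^ (m - 1 - i)) * cycle_weight R)))
      + (\<Sum>d\<in>R. real (length d) * g ((1 - fps_X ^ (length d + m)) * cycle_weight (R - {d}))))"
      unfolding cyclic_sum_recursion[OF fin z w t, folded v_def] 1 h_def[symmetric]
      using 2 by simp
    also have "\<dots> = fps_nth (orbit_gf (card S) ((1 - fps_X ^ (m + 1)) * cycle_weight R)) q"
      unfolding g_def
      by (subst orbit_gf_recursion[OF finR card[folded m_def]])
        (simp_all add: m fps_sum_nth fps_of_nat[symmetric])
    finally show ?thesis unfolding weight by (simp add: m_def)
  qed
qed

section \<open>The vertices of the glued surface as orbits\<close>

lemma cycle_of_list_nth:
  assumes "distinct l" "i < length l"
  shows "cycle_of_list l (l ! i) = l ! (Suc i mod length l)"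
proof -
  have "map (cycle_of_list l) l = rotate 1 l"
    using cyclic_rotation[OF assms(1), of 1] by simp
  then have "map (cycle_of_list l) l ! i = rotate 1 l ! i" by simp
  then show ?thesis using assms(2) by (simp only: nth_map nth_rotate) simp
qed

text \<open>
  The identity outside the sides of the small polygons, so that it is a permutation in the sense
  of \<open>permutes\<close>.
\<close>

definition polygon_rotation :: "nat \<Rightarrow> nat \<Rightarrow> nat \<times> nat \<Rightarrow> nat \<times> nat" where
  "polygon_rotation k M s =
     (if s \<in> {..<k} \<times> {..<M} then (fst s, Suc (snd s) mod M) else s)"

lemma polygon_rotation_permutes: "polygon_rotation k M permutes {..<k} \<times> {..<M}"
proof (rule bij_imp_permutes)
  let ?S = "{..<k} \<times> {..<M}" and ?\<sigma> = "polygon_rotation k M"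
  have "inj_on ?\<sigma> ?S"
    by (auto simp: inj_on_def polygon_rotation_def mod_Suc split: if_splits)
  moreover have "?\<sigma> ` ?S \<subseteq> ?S" by (auto simp: polygon_rotation_def)
  ultimately show "bij_betw ?\<sigma> ?S ?S"
    by (simp add: bij_betw_def endo_inj_surj)
qed (simp add: polygon_rotation_def)

definition polygon_cycles :: "nat \<Rightarrow> nat \<Rightarrow> (nat \<times> nat) list set" where
  "polygon_cycles k M = (\<lambda>a. map (Pair a) [0..<M]) ` {..<k}"

lemma polygon_cycles:
  assumes "M > 0"
  shows "disjoint_cycles (polygon_cycles k M) (polygon_rotation k M)"
    and "\<Union> (set ` polygon_cycles k M) = {..<k} \<times> {..<M}"
    and "cycle_weight (polygon_cycles k M) = (1 - fps_X ^ M) ^ k"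
proof -
  obtain N where M: "M = Suc N" using assms gr0_implies_Suc by blast
  have "is_cycle (polygon_rotation k M) (map (Pair a) [0..<M])" if "a < k" for a
  proof -
    have "map (polygon_rotation k M) ((a, N) # map (Pair a) [0..<N]) =
        (a, 0) # map (Pair a) (map Suc [0..<N])"
      using that by (auto simp: polygon_rotation_def M)
    also have "\<dots> = map (Pair a) (0 # [Suc 0..<Suc N])" by (simp only: map_Suc_upt list.map)
    also have "0 # [Suc 0..<Suc N] = [0..<Suc N]" by (simp add: upt_conv_Cons del: upt_Suc)
    finally show ?thesis
      using is_cycle_snoc[of "polygon_rotation k M" "map (Pair a) [0..<N]" "(a, N)"]
      by (auto simp: M distinct_map inj_on_def)
  qed
  then show "disjoint_cycles (polygon_cycles k M) (polygon_rotation k M)"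
    by (auto simp: disjoint_cycles_def polygon_cycles_def pairwise_def)
  show "\<Union> (set ` polygon_cycles k M) = {..<k} \<times> {..<M}"
    by (auto simp: polygon_cycles_def)
  have "inj_on (\<lambda>a. map (Pair a) [0..<M]) {..<k}"
    by (rule inj_onI) (simp add: M upt_conv_Cons del: upt_Suc)
  then show "cycle_weight (polygon_cycles k M) = (1 - fps_X ^ M) ^ k"
    by (simp add: cycle_weight_def polygon_cycles_def prod.reindex)
qed

lemma bipartite_pairingsD:
  assumes "f \<in> bipartite_pairings k M"
  shows "bij_betw f {..<k * M} ({..<k} \<times> {..<M})"
  using assms by (simp add: bipartite_pairings_def)

text \<open>
  Every corner \<open>i\<close> of the big polygon is glued to the corner \<open>\<sigma> (f i)\<close> of a small polygon, where \<open>\<sigma>\<close>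
  is \<open>polygon_rotation\<close>, so it suffices to consider small corners. The other gluing, of corner
  \<open>i + 1\<close> to \<open>f i\<close>, then says that \<open>f i\<close> is identified with \<open>\<sigma> (f (i + 1))\<close>.
\<close>

lemma card_surface_vertices:
  assumes f: "f \<in> bipartite_pairings k M"
  shows "card (surface_vertices k M f) = orbit_count ({..<k} \<times> {..<M})
           (polygon_rotation k M \<circ> cycle_of_list (map f [0..<k * M]))"
proof -
  let ?S = "{..<k} \<times> {..<M}" and ?\<sigma> = "polygon_rotation k M"
  let ?n = "k * M"
  note bij = bipartite_pairingsD[OF f]
  define p where "p = ?\<sigma> \<circ> cycle_of_list (map f [0..<?n])"
  have fS: "f i \<in> ?S" if "i < ?n" for i using bij_betwE[OF bij] that by auto
  have \<sigma>S: "?\<sigma> s \<in> ?S" if "s \<in> ?S" for s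
    using that polygon_rotation_permutes[of k M] by (simp add: permutes_in_image)
  have p: "p (f i) = ?\<sigma> (f (Suc i mod ?n))" if "i < ?n" for i
  proof -
    have "distinct (map f [0..<?n])"
      using bij by (auto simp: distinct_map bij_betw_def atLeast0LessThan)
    moreover have "Suc i mod ?n < ?n" using that by (intro mod_less_divisor) linarith
    ultimately show ?thesis using cycle_of_list_nth[of "map f [0..<?n]" i] that by (simp add: p_def)
  qed
  have next_Inr: "next_side k M (Inr s) = Inr (?\<sigma> s)" if "s \<in> ?S" for s
    using that by (cases s) (auto simp: polygon_rotation_def)
  let ?R = "corner_gluing k M f" and ?R' = "{(s, p s) |s. s \<in> ?S}"
  let ?h = "\<lambda>x. case x of Inl i \<Rightarrow> ?\<sigma> (f i) | Inr s \<Rightarrow> s"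
  have glue: "(Inr (?\<sigma> (f i)), Inl i) \<in> equiv_closure ?R"
    "(Inr (f i), Inl (Suc i mod ?n)) \<in> equiv_closure ?R" if "i < ?n" for i
  proof -
    have "(Inl i, Inr (?\<sigma> (f i))) \<in> ?R" "(Inl (Suc i mod ?n), Inr (f i)) \<in> ?R"
      unfolding corner_gluing_def next_Inr[OF fS[OF that], symmetric] next_side.simps(1)[symmetric]
      using that by blast+
    then show "(Inr (?\<sigma> (f i)), Inl i) \<in> equiv_closure ?R"
      "(Inr (f i), Inl (Suc i mod ?n)) \<in> equiv_closure ?R"
      by (blast intro: r_into_rtrancl)+
  qed
  have "card (sides k M // equiv_closure ?R) = card (?S // equiv_closure ?R')"
  proof (rule card_quotient_eq[where h = ?h and g = Inr])
    show "?h ` sides k M \<subseteq> ?S"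
    proof (rule image_subsetI)
      fix x assume "x \<in> sides k M"
      then consider i where "x = Inl i" "i < ?n" | s where "x = Inr s" "s \<in> ?S"
        unfolding sides_def by blast
      then show "?h x \<in> ?S" by cases (simp_all add: fS \<sigma>S del: mem_Sigma_iff)
    qed
    show "Inr ` ?S \<subseteq> sides k M" by (auto simp: sides_def)
    show "(?h x, ?h y) \<in> equiv_closure ?R'" if "(x, y) \<in> ?R" for x y
    proof -
      from that obtain i where i: "i < ?n" and "(x, y) = (Inl i, next_side k M (Inr (f i))) \<or>
          (x, y) = (next_side k M (Inl i), Inr (f i))"
        unfolding corner_gluing_def by blast
      then have xy: "x = Inl i \<and> y = Inr (?\<sigma> (f i)) \<or> x = Inl (Suc i mod ?n) \<and> y = Inr (f i)"
        using next_Inr[OF fS[OF i]] by simp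
      have "(f i, p (f i)) \<in> ?R'" by (intro CollectI exI[of _ "f i"] conjI refl fS[OF i])
      then have "(p (f i), f i) \<in> equiv_closure ?R'" by (intro r_into_rtrancl UnI2 converseI)
      with xy show ?thesis by (elim disjE conjE) (simp_all add: p[OF i])
    qed
    show "(Inr s, Inr t) \<in> equiv_closure ?R" if "(s, t) \<in> ?R'" for s t
    proof -
      from that have "s \<in> ?S" and t: "t = p s" by (elim CollectE exE conjE; simp)+
      then obtain i where i: "i < ?n" "s = f i" using bij_betw_imp_surj_on[OF bij] by blast
      then have i': "Suc i mod ?n < ?n" by (intro mod_less_divisor) linarith
      have "(Inr (f i), Inr (?\<sigma> (f (Suc i mod ?n)))) \<in> equiv_closure ?R"
        using glue(2)[OF i(1)] equiv_closure_sym[OF glue(1)[OF i']] by (rule rtrancl_trans)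
      then show ?thesis by (simp only: t i(2) p[OF i(1)])
    qed
    show "(Inr (?h x), x) \<in> equiv_closure ?R" if "x \<in> sides k M" for x
    proof -
      from that consider i where "x = Inl i" "i < ?n" | s where "x = Inr s"
        unfolding sides_def by blast
      then show ?thesis by cases (simp_all add: glue(1))
    qed
    show "(?h (Inr s), s) \<in> equiv_closure ?R'" for s by simp
  qed
  then show ?thesis by (simp add: surface_vertices_def orbit_count_def p_def)
qed

lemma has_genus_iff:
  assumes "f \<in> bipartite_pairings k M" "k > 0" "M > 0"
  shows "has_genus k M f g \<longleftrightarrow> card (surface_vertices k M f) + 2 * g + k = k * M + 1"
proof -
  have "inj_on (\<lambda>i. {Inl i, Inr (f i)} :: side set) {..<k * M}"
    by (rule inj_onI) (auto simp: doubleton_eq_iff)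
  then have "card (surface_edges k M f) = k * M"
    by (simp add: surface_edges_def card_image)
  moreover have "card (surface_faces k M) = Suc k"
  proof -
    have ne: "Inl ` {..<k * M} \<noteq> (Inr ` ({a} \<times> {..<M}) :: side set)" for a
    proof -
      have "Inl 0 \<in> (Inl ` {..<k * M} :: side set)" using assms(2,3) by simp
      then show ?thesis by auto
    qed
    have "inj_on (\<lambda>a. Inr ` ({a} \<times> {..<M}) :: side set) {..<k}"
    proof (rule inj_onI)
      fix a b assume "Inr ` ({a} \<times> {..<M}) = (Inr ` ({b} \<times> {..<M}) :: side set)"
      then have "Inr (a, 0) \<in> (Inr ` ({b} \<times> {..<M}) :: side set)" using assms(3) by blast
      then show "a = b" by auto
    qed
    then show ?thesis unfolding surface_faces_def using ne
      by (subst card_insert_disjoint) (auto simp: card_image)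
  qed
  ultimately show ?thesis unfolding has_genus_def euler_char_def by linarith
qed

lemma bij_betw_bipartite_pairings:
  "bij_betw (\<lambda>f. map f [0..<k * M]) (bipartite_pairings k M)
     (permutations_of_set ({..<k} \<times> {..<M}))"
proof (rule bij_betw_byWitness[where f' = "\<lambda>l. \<lambda>i\<in>{..<k * M}. l ! i"])
  let ?S = "{..<k} \<times> {..<M}" and ?n = "k * M"
  show "\<forall>f\<in>bipartite_pairings k M. (\<lambda>i\<in>{..<?n}. map f [0..<?n] ! i) = f"
  proof (intro ballI ext)
    fix f i assume "f \<in> bipartite_pairings k M"
    then have "f i = undefined" if "i \<notin> {..<?n}"
      using that unfolding bipartite_pairings_def by (blast intro: PiE_arb)
    then show "(\<lambda>i\<in>{..<?n}. map f [0..<?n] ! i) i = f i" by (cases "i < ?n") simp_all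
  qed
  have len: "length l = ?n" if "l \<in> permutations_of_set ?S" for l
    using length_finite_permutations_of_set[OF that] by simp
  show "\<forall>l\<in>permutations_of_set ?S. map (\<lambda>i\<in>{..<?n}. l ! i) [0..<?n] = l"
    by (auto intro: nth_equalityI simp: len)
  show "(\<lambda>f. map f [0..<?n]) ` bipartite_pairings k M \<subseteq> permutations_of_set ?S"
    by (rule image_subsetI, drule bipartite_pairingsD)
      (simp add: permutations_of_set_def bij_betw_def distinct_map atLeast0LessThan)
  show "(\<lambda>l. \<lambda>i\<in>{..<?n}. l ! i) ` permutations_of_set ?S \<subseteq> bipartite_pairings k M"
  proof
    fix f assume "f \<in> (\<lambda>l. \<lambda>i\<in>{..<?n}. l ! i) ` permutations_of_set ?S"
    then obtain l where l: "l \<in> permutations_of_set ?S" and f: "f = (\<lambda>i\<in>{..<?n}. l ! i)" by auto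
    have "bij_betw (nth l) {..<?n} ?S"
      using l len[OF l] by (intro bij_betw_nth) (auto simp: permutations_of_set_def)
    then have "bij_betw f {..<?n} ?S"
      by (rule bij_betw_cong[THEN iffD1, rotated]) (simp add: f)
    then show "f \<in> bipartite_pairings k M"
      using bij_betw_imp_funcset[of f "{..<?n}" ?S] f
      by (simp add: bipartite_pairings_def PiE_def del: mem_Sigma_iff)
  qed
qed

text \<open>
  A pairing is a list of all sides of the small polygons. The lists with a given first entry
  correspond to the full cycles, so each of the \<open>k * M\<close> first entries contributes the same sum.
\<close>

lemma sum_pairings_eq_orbit_gf:
  assumes "k > 0" "M > 0"
  shows "(\<Sum>f\<in>bipartite_pairings k M. real q ^ card (surface_vertices k M f)) =
    real (k * M) * fps_nth (orbit_gf (k * M) ((1 - fps_X ^ M) ^ k)) q"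
proof -
  let ?S = "{..<k} \<times> {..<M}" and ?\<sigma> = "polygon_rotation k M"
  let ?F = "\<lambda>l. real q ^ orbit_count ?S (?\<sigma> \<circ> cycle_of_list l)"
  have ne: "?S \<noteq> {}" using assms by (auto simp: lessThan_empty_iff)
  have "(\<Sum>f\<in>bipartite_pairings k M. real q ^ card (surface_vertices k M f)) =
      (\<Sum>f\<in>bipartite_pairings k M. ?F (map f [0..<k * M]))"
    by (intro sum.cong refl) (simp only: card_surface_vertices)
  also have "\<dots> = (\<Sum>l\<in>permutations_of_set ?S. ?F l)"
    by (rule sum.reindex_bij_betw[OF bij_betw_bipartite_pairings])
  also have "\<dots> = (\<Sum>z\<in>?S. \<Sum>l\<in>(#) z ` permutations_of_set (?S - {z}). ?F l)"
    unfolding permutations_of_set_nonempty[OF ne] by (rule sum.UNION_disjoint) auto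
  also have "\<dots> = (\<Sum>z\<in>?S. cyclic_sum (real q) ?S ?\<sigma> z)"
    unfolding cyclic_sum_def
  proof (rule sum.cong[OF refl])
    fix z
    show "(\<Sum>l\<in>(#) z ` permutations_of_set (?S - {z}). ?F l) =
        (\<Sum>l\<in>permutations_of_set (?S - {z}). ?F (z # l))"
      by (subst sum.reindex) auto
  qed
  also have "\<dots> = (\<Sum>z\<in>?S. fps_nth (orbit_gf (card ?S) (cycle_weight (polygon_cycles k M))) q)"
    by (intro sum.cong refl cyclic_sum_eq_orbit_gf polygon_cycles(1) polygon_rotation_permutes
        polygon_cycles(2)[symmetric] assms)
  finally show ?thesis by (simp add: polygon_cycles(3)[OF assms(2)])
qed

section \<open>Extracting the Stirling numbers\<close>

lemma geom_power_nth: "fps_nth (geom ^ Suc n) i = real ((n + i) choose n)"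
proof -
  have "inverse ((1 - fps_X :: real fps) ^ Suc n) = Abs_fps (\<lambda>i. real ((n + i) choose i))"
    using one_minus_const_fps_X_neg_power'[of "Suc n" "1 :: real"] by (simp del: power_Suc)
  then have "geom ^ Suc n = Abs_fps (\<lambda>i. real ((n + i) choose i))"
    by (simp only: fps_inverse_power)
  then have "fps_nth (geom ^ Suc n) i = real ((n + i) choose i)" by (simp only: fps_nth_Abs_fps)
  then show ?thesis using binomial_symmetric[of i "n + i"] by simp
qed

text \<open>
  The bound on \<open>q\<close> makes \<open>q - j * M\<close> positive for every \<open>j \<le> k\<close>, so that all terms of the expansion
  of \<open>(1 - X^M)^k\<close> reach the coefficient of \<open>X^q\<close> and each coefficient is a binomial number
  \<open>(q - j * M + n) choose (n + 1)\<close>, that is, a rising factorial divided by \<open>(n + 1)!\<close>.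
\<close>

lemma orbit_gf_polygons_nth:
  assumes n: "n = k * M" "n > 0" and q: "q > n"
  shows "real n * fps_nth (orbit_gf n ((1 - fps_X ^ M) ^ k)) q =
    (\<Sum>j\<le>k. (-1) ^ j * real (k choose j) * pochhammer (real q - real (j * M)) (n + 1)) / real (n + 1)"
proof -
  have "(1 - fps_X ^ M) ^ k = (- (fps_X ^ M) + 1 :: real fps) ^ k" by simp
  also have "\<dots> = (\<Sum>j\<le>k. of_nat (k choose j) * (- (fps_X ^ M)) ^ j)"
    by (subst binomial_ring) simp
  also have "\<dots> = (\<Sum>j\<le>k. fps_const ((-1) ^ j * real (k choose j)) * fps_X ^ (M * j))"
  proof (intro sum.cong refl)
    fix j
    have "(- (fps_X ^ M)) ^ j = fps_const ((-1) ^ j) * (fps_X ^ (M * j) :: real fps)"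
      unfolding power_minus[of "fps_X ^ M"]
      by (simp add: power_mult fps_const_power[symmetric] fps_const_neg[symmetric]
          del: fps_const_power fps_const_neg)
    then show "of_nat (k choose j) * (- (fps_X ^ M)) ^ j =
        fps_const ((-1) ^ j * real (k choose j)) * (fps_X ^ (M * j) :: real fps)"
      by (simp add: fps_of_nat[symmetric] mult_ac flip: fps_const_mult)
  qed
  finally have "orbit_gf n ((1 - fps_X ^ M) ^ k) = fps_const (fact (n - 1)) *
      (\<Sum>j\<le>k. fps_const ((-1) ^ j * real (k choose j)) * (fps_X ^ Suc (M * j) * geom ^ Suc (n + 1)))"
    by (simp add: orbit_gf_def sum_distrib_left sum_distrib_right mult_ac
        flip: fps_of_nat del: fps_const_mult)
  then have "real n * fps_nth (orbit_gf n ((1 - fps_X ^ M) ^ k)) q = real n * fact (n - 1) *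
      (\<Sum>j\<le>k. (-1) ^ j * real (k choose j) * fps_nth (fps_X ^ Suc (M * j) * geom ^ Suc (n + 1)) q)"
    by (simp add: fps_sum_nth mult.assoc del: power_Suc)
  also have "real n * fact (n - 1) = (fact n :: real)" using n(2) by (simp add: fact_reduce)
  also have "(\<Sum>j\<le>k. (-1) ^ j * real (k choose j)
        * fps_nth (fps_X ^ Suc (M * j) * geom ^ Suc (n + 1)) q) =
      (\<Sum>j\<le>k. (-1) ^ j * real (k choose j) * (pochhammer (real q - real (j * M)) (n + 1) / fact (n + 1)))"
  proof (intro sum.cong refl arg_cong2[where f = "(*)"])
    fix j assume "j \<in> {..k}"
    then have "M * j < q" using q n(1) by (metis atMost_iff le_less_trans mult.commute mult_le_mono1)
    then obtain r where r: "q = M * j + Suc r" using less_iff_Suc_add by auto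
    have "fps_nth (fps_X ^ Suc (M * j) * geom ^ Suc (n + 1)) q = real ((n + 1 + r) choose (n + 1))"
      unfolding fps_X_power_mult_nth geom_power_nth by (simp add: r)
    also have "\<dots> = pochhammer (real (Suc r)) (n + 1) / fact (n + 1)"
    proof -
      have "real (n + 1 + r) - real (n + 1) + 1 = real (Suc r)" by simp
      then show ?thesis by (simp only: binomial_gbinomial gbinomial_pochhammer')
    qed
    finally show "fps_nth (fps_X ^ Suc (M * j) * geom ^ Suc (n + 1)) q =
        pochhammer (real q - real (j * M)) (n + 1) / fact (n + 1)"
      by (simp add: r mult.commute)
  qed
  finally have eq: "real n * fps_nth (orbit_gf n ((1 - fps_X ^ M) ^ k)) q = fact n *
      (\<Sum>j\<le>k. (-1) ^ j * real (k choose j) * (pochhammer (real q - real (j * M)) (n + 1) / fact (n + 1)))" .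
  have cancel: "fact n * (a * (b / fact (n + 1))) = a * b / real (n + 1)" for a b :: real
  proof -
    have "x \<noteq> 0 \<Longrightarrow> x * (a * (b / (y * x))) = a * b / y" for x y :: real by simp
    moreover have "fact (n + 1) = real (n + 1) * fact n" by simp
    ultimately show ?thesis using fact_nonzero by metis
  qed
  show ?thesis by (simp only: eq sum_distrib_left sum_divide_distrib cancel)
qed

text \<open>
  Up to the sign, this is the count of the surjections from \<open>m\<close> onto \<open>k\<close> points by inclusion and
  exclusion. The proof checks that both sides satisfy the recursion of the Stirling numbers; for the left-hand
  side this follows from \<open>j (k choose j) = k ((k choose j) - (k - 1 choose j))\<close>.
\<close>

lemma sum_alternating_binomial_power:
  "(\<Sum>j\<le>k. (-1) ^ j * real (k choose j) * real j ^ m) = (-1) ^ k * fact k * real (Stirling m k)"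
proof (induction m arbitrary: k)
  case 0
  show ?case
  proof (cases k)
    case (Suc l)
    have "(\<Sum>j\<le>k. (-1) ^ j * real (k choose j)) = 0"
      using choose_alternating_sum[of k, where 'a = real] Suc by simp
    then show ?thesis by (simp add: Suc)
  qed simp
next
  case (Suc m)
  show ?case
  proof (cases k)
    case (Suc l)
    have absorb: "real (Suc l choose j) * real j =
        real (Suc l) * (real (Suc l choose j) - real (l choose j))" for j
    proof (cases j)
      case (Suc i)
      have "real (Suc l choose Suc i) * real (Suc i) = real (Suc l) * real (l choose i)"
        using Suc_times_binomial_eq[of l i] by (metis of_nat_mult mult.commute)
      then show ?thesis by (simp add: Suc)
    qed simp
    have "(\<Sum>j\<le>k. (-1) ^ j * real (k choose j) * real j ^ Suc m) =
        (\<Sum>j\<le>k. real k * ((-1) ^ j * real (k choose j) * real j ^ m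
           - (-1) ^ j * real (l choose j) * real j ^ m))"
    proof (intro sum.cong refl)
      fix j
      have "(-1) ^ j * real (k choose j) * real j ^ Suc m =
          (-1) ^ j * real j ^ m * (real (Suc l choose j) * real j)"
        by (simp add: Suc)
      then show "(-1) ^ j * real (k choose j) * real j ^ Suc m =
         real k * ((-1) ^ j * real (k choose j) * real j ^ m
           - (-1) ^ j * real (l choose j) * real j ^ m)"
        unfolding absorb by (simp add: Suc algebra_simps)
    qed
    also have "\<dots> = real k * ((\<Sum>j\<le>k. (-1) ^ j * real (k choose j) * real j ^ m)
        - (\<Sum>j\<le>k. (-1) ^ j * real (l choose j) * real j ^ m))"
      by (simp only: sum_subtractf[symmetric] sum_distrib_left)
    also have "(\<Sum>j\<le>k. (-1) ^ j * real (l choose j) * real j ^ m) =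
        (\<Sum>j\<le>l. (-1) ^ j * real (l choose j) * real j ^ m)"
      by (simp add: Suc)
    finally show ?thesis unfolding Suc.IH by (simp add: Suc algebra_simps)
  qed simp
qed

text \<open>
  Both sides are the coefficients at \<open>v\<close> of polynomials, \<open>P\<close> and \<open>Q\<close> in the proof, whose values
  agree at all integers \<open>q > k * M\<close>.
\<close>

lemma card_pairings_with_vertices:
  assumes "k > 0" "M > 0"
  shows "real (card {f \<in> bipartite_pairings k M. card (surface_vertices k M f) = v}) =
    (-1) ^ k * fact k / real (k * M + 1) *
      (\<Sum>m\<le>k * M + 1. real (stirling (k * M + 1) m) * real (m choose v)
         * real (Stirling (m - v) k) * (- real M) ^ (m - v))"
proof -
  define n where "n = k * M"
  define V where "V f = card (surface_vertices k M f)" for f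
  define c where "c v = (-1) ^ k * fact k / real (n + 1) *
      (\<Sum>m\<le>n + 1. real (stirling (n + 1) m) * real (m choose v)
         * real (Stirling (m - v) k) * (- real M) ^ (m - v))" for v
  have fin: "finite (bipartite_pairings k M)"
    using bij_betw_finite[OF bij_betw_bipartite_pairings[of k M]] by simp
  define P where "P = (\<Sum>f\<in>bipartite_pairings k M. monom (1 :: real) (V f))"
  define Q where "Q = (\<Sum>v\<le>n + 1. monom (c v) v)"
  have Q: "poly Q x = (\<Sum>j\<le>k. (-1) ^ j * real (k choose j)
      * pochhammer (x - real (j * M)) (n + 1)) / real (n + 1)" for x
  proof -
    define A where "A j m v = (-1) ^ j * real (k choose j) * (real (stirling (n + 1) m)
        * (real (m choose v) * x ^ v * (- real (j * M)) ^ (m - v)))" for j m v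
    have poch: "pochhammer (x - real (j * M)) (n + 1) = (\<Sum>m\<le>n + 1. real (stirling (n + 1) m)
        * (\<Sum>v\<le>n + 1. real (m choose v) * x ^ v * (- real (j * M)) ^ (m - v)))" for j
      unfolding stirling_pochhammer[symmetric]
    proof (intro sum.cong refl arg_cong2[where f = "(*)"])
      fix m assume "m \<in> {..n + 1}"
      then have "(\<Sum>v\<le>m. real (m choose v) * x ^ v * (- real (j * M)) ^ (m - v)) =
         (\<Sum>v\<le>n + 1. real (m choose v) * x ^ v * (- real (j * M)) ^ (m - v))"
        by (intro sum.mono_neutral_left) auto
      then show "(x - real (j * M)) ^ m =
          (\<Sum>v\<le>n + 1. real (m choose v) * x ^ v * (- real (j * M)) ^ (m - v))"
        using binomial_ring[of x "- real (j * M)" m] by simp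
    qed
    have cv: "c v * x ^ v * real (n + 1) = (\<Sum>m\<le>n + 1. \<Sum>j\<le>k. A j m v)" for v
    proof -
      have "(\<Sum>j\<le>k. A j m v) = (-1) ^ k * fact k * (real (stirling (n + 1) m) * real (m choose v)
         * real (Stirling (m - v) k) * (- real M) ^ (m - v)) * x ^ v" for m
      proof -
        have "A j m v = real (stirling (n + 1) m) * real (m choose v) * x ^ v * (- real M) ^ (m - v)
            * ((-1) ^ j * real (k choose j) * real j ^ (m - v))" for j
        proof -
          have "(- real (j * M)) ^ (m - v) = (- real M) ^ (m - v) * real j ^ (m - v)"
            by (simp flip: power_mult_distrib add: mult.commute)
          then show ?thesis by (simp only: A_def mult_ac)
        qed
        then have "(\<Sum>j\<le>k. A j m v) =
            real (stirling (n + 1) m) * real (m choose v) * x ^ v * (- real M) ^ (m - v)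
            * ((-1) ^ k * fact k * real (Stirling (m - v) k))"
          by (simp only: sum_distrib_left[symmetric] sum_alternating_binomial_power)
        then show ?thesis by (simp only: mult_ac)
      qed
      then have "(\<Sum>m\<le>n + 1. \<Sum>j\<le>k. A j m v) = (-1) ^ k * fact k *
          (\<Sum>m\<le>n + 1. real (stirling (n + 1) m) * real (m choose v)
            * real (Stirling (m - v) k) * (- real M) ^ (m - v)) * x ^ v"
        by (simp only: sum_distrib_left sum_distrib_right)
      also have "\<dots> = c v * real (n + 1) * x ^ v"
        unfolding c_def by (simp del: of_nat_Suc of_nat_add sum.atMost_Suc)
      finally show ?thesis by (simp only: mult_ac)
    qed
    have "poly Q x * real (n + 1) = (\<Sum>v\<le>n + 1. c v * x ^ v * real (n + 1))"
      by (simp only: Q_def poly_sum poly_monom sum_distrib_right)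
    also have "\<dots> = (\<Sum>v\<le>n + 1. \<Sum>m\<le>n + 1. \<Sum>j\<le>k. A j m v)" by (simp only: cv)
    also have "\<dots> = (\<Sum>m\<le>n + 1. \<Sum>j\<le>k. \<Sum>v\<le>n + 1. A j m v)"
      by (subst sum.swap) (intro sum.cong refl sum.swap)
    also have "\<dots> = (\<Sum>j\<le>k. \<Sum>m\<le>n + 1. \<Sum>v\<le>n + 1. A j m v)" by (rule sum.swap)
    also have "\<dots> = (\<Sum>j\<le>k. (-1) ^ j * real (k choose j) * pochhammer (x - real (j * M)) (n + 1))"
      unfolding poch A_def by (simp only: sum_distrib_left)
    finally show ?thesis by (simp add: field_simps del: of_nat_Suc)
  qed
  have "poly P (real q) = poly Q (real q)" if "q > n" for q
  proof -
    have "poly P (real q) = (\<Sum>f\<in>bipartite_pairings k M. real q ^ V f)"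
      by (simp add: P_def poly_sum poly_monom)
    also have "\<dots> = real n * fps_nth (orbit_gf n ((1 - fps_X ^ M) ^ k)) q"
      unfolding V_def n_def by (rule sum_pairings_eq_orbit_gf[OF assms])
    also have "\<dots> = poly Q (real q)"
      unfolding Q using assms that by (intro orbit_gf_polygons_nth) (auto simp: n_def)
    finally show ?thesis .
  qed
  then have roots: "real ` {n<..} \<subseteq> {x. poly (P - Q) x = 0}" by (intro image_subsetI) simp
  have inf: "infinite (real ` {n<..})"
    using infinite_Ioi[of n] by (subst finite_image_iff) (auto intro: inj_onI)
  have "P = Q"
  proof (rule ccontr)
    assume "P \<noteq> Q"
    then have "finite {x. poly (P - Q) x = 0}" by (intro poly_roots_finite) simp
    then show False using finite_subset[OF roots] inf by blast
  qed
  then have "coeff P v = coeff Q v" by simp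
  moreover have "coeff P v = real (card {f \<in> bipartite_pairings k M. V f = v})"
    using fin by (simp add: P_def coeff_sum coeff_monom sum.If_cases Int_def)
  moreover have "coeff Q v = c v"
  proof (cases "v \<le> n + 1")
    case True
    then show ?thesis by (simp add: Q_def coeff_sum del: sum.atMost_Suc)
  next
    case False
    then have "(\<Sum>m\<le>n + 1. real (stirling (n + 1) m) * real (m choose v)
         * real (Stirling (m - v) k) * (- real M) ^ (m - v)) = 0"
      by (intro sum.neutral) auto
    then have "c v = 0" unfolding c_def by (simp only: mult_zero_right)
    with False show ?thesis by (simp add: Q_def coeff_sum del: sum.atMost_Suc)
  qed
  ultimately show ?thesis by (simp only: V_def n_def c_def)
qed

text \<open>
  Genus \<open>g\<close> amounts to \<open>v = k * M + 1 - k - 2 * g\<close> vertices, and the substitution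
  \<open>m = v + k + p\<close> turns \<open>card_pairings_with_vertices\<close> into the claim: below \<open>v + k\<close> a binomial
  coefficient or a Stirling number of the second kind vanishes. If the number \<open>v\<close> is negative,
  then there are no pairings of genus \<open>g\<close>, and in every term on the right the lower index of the binomial
  coefficient exceeds the upper one.
\<close>

theorem theorem1p4:
  fixes k M g :: nat
  assumes "k > 0" and "M > 0"
  shows "real (eps g k M) =
    (- 1) ^ k * fact k / real (k * M + 1) *
      (\<Sum>p = 0..2 * g.
         real (stirling_int (k * M + 1) (int (p + k * M + 1) - int (2 * g))) *
         real (nat (int (p + k * M + 1) - int (2 * g)) choose (p + k)) *
         real (Stirling (p + k) k) *
         (- real M) ^ (p + k))"
proof -
  let ?N = "k * M + 1"
  let ?t = "\<lambda>p. real (stirling_int ?N (int (p + k * M + 1) - int (2 * g))) *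
         real (nat (int (p + k * M + 1) - int (2 * g)) choose (p + k)) *
         real (Stirling (p + k) k) * (- real M) ^ (p + k)"
  have eps: "eps g k M = card {f \<in> bipartite_pairings k M.
      card (surface_vertices k M f) + 2 * g + k = ?N}"
    unfolding eps_def by (rule arg_cong[where f = card]) (auto simp: has_genus_iff[OF _ assms])
  show ?thesis
  proof (cases "2 * g + k \<le> ?N")
    case False
    \<comment> \<open>If \<open>int (p + k * M + 1) - int (2 * g)\<close> is negative, \<open>nat\<close> turns it into \<open>0\<close>, which
      is less than \<open>p + k\<close>, so the binomial coefficient vanishes in this case as well.\<close>
    have "?t p = 0" for p
    proof -
      have "int (p + k * M + 1) - int (2 * g) < int (p + k)" using False by linarith
      moreover have "nat x < b" if "x < int b" "0 < b" for x b using that by linarith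
      ultimately have "nat (int (p + k * M + 1) - int (2 * g)) < p + k" using assms(1) by blast
      then show ?thesis by (simp only: binomial_eq_0)
    qed
    then have "(\<Sum>p = 0..2 * g. ?t p) = 0" by (intro sum.neutral) blast
    moreover have "eps g k M = 0" unfolding eps using False by auto
    ultimately show ?thesis by simp
  next
    case True
    define v where "v = ?N - (2 * g + k)"
    have v: "v + 2 * g + k = ?N" using True by (simp add: v_def)
    define u where "u m = real (stirling ?N m) * real (m choose v)
         * real (Stirling (m - v) k) * (- real M) ^ (m - v)" for m
    have "eps g k M = card {f \<in> bipartite_pairings k M. card (surface_vertices k M f) = v}"
      unfolding eps using v by (intro arg_cong[where f = card]) auto
    then have "real (eps g k M) = (-1) ^ k * fact k / real ?N * (\<Sum>m\<le>?N. u m)"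
      using card_pairings_with_vertices[OF assms, of v] by (simp only: u_def)
    also have "(\<Sum>m\<le>?N. u m) = (\<Sum>m = 0 + (v + k)..2 * g + (v + k). u m)"
    proof (rule sum.mono_neutral_right)
      show "\<forall>m\<in>{..?N} - {0 + (v + k)..2 * g + (v + k)}. u m = 0"
      proof
        fix m assume "m \<in> {..?N} - {0 + (v + k)..2 * g + (v + k)}"
        then have "m < v \<or> m - v < k" using v by auto
        then show "u m = 0" by (auto simp: u_def)
      qed
    qed (use v in auto)
    also have "\<dots> = (\<Sum>p = 0..2 * g. u (p + (v + k)))" by (rule sum.shift_bounds_cl_nat_ivl)
    also have "\<dots> = (\<Sum>p = 0..2 * g. ?t p)"
    proof (intro sum.cong refl)
      fix p
      have "int (p + k * M + 1) - int (2 * g) = int (p + (v + k))" using v by linarith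
      moreover have "(p + (v + k)) choose v = (p + (v + k)) choose (p + k)"
        using binomial_symmetric[of v "p + (v + k)"] by simp
      ultimately show "u (p + (v + k)) = ?t p"
        by (simp add: u_def stirling_int_def del: of_nat_add)
    qed
    finally show ?thesis .
  qed
qed

end
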